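(* Let $n\ge 2$. The algebra ${}^{D}\Lambda_n^-\subset \mathrm{Pol}_n^-$ of spin type D symmetric polynomials is a polynomial algebra (over $\mathbb{Z}$) generated by ${}^{D}\varepsilon_1^-,{}^{D}\varepsilon_2^-,\dots,{}^{D}\varepsilon_n^-$.
   Context: $\mathrm{Pol}_n^-$ is the unital $\mathbb{Z}$-algebra generated by $x_1,\dots,x_n$ subject to $x_ix_j+x_jx_i=0$ for all $i\ne j$. For $1\le i\le n-1$ let $s_i$ be the algebra endomorphism of $\mathrm{Pol}_n^-$ with $s_i(x_i)=-x_{i+1}$, $s_i(x_{i+1})=-x_i$, $s_i(x_j)=-x_j$ for $j\ne i,i+1$, and let $s_n^D$ be the algebra endomorphism with $s_n^D(x_n)=x_{n-1}$, $s_n^D(x_{n-1})=x_n$, $s_n^D(x_j)=-x_j$ for $j\le n-2$. The type D odd Demazure operators are the $\mathbb{Z}$-linear operators $\partial_i^-$ ($1\le i\le n-1$) and $\partial_n^D$ on $\mathrm{Pol}_n^-$ that kill $1$ and satisfy: $\partial_i^-(x_j)=1$ if $j\in\{i,i+1\}$ and $0$ otherwise; $\partial_n^D(x_n)=-1$, $\partial_n^D(x_{n-1})=1$, $\partial_n^D(x_j)=0$ for $j\le n-2$; and $\partial_i^-(fg)=\partial_i^-(f)g+s_i(f)\partial_i^-(g)$, $\partial_n^D(fg)=\partial_n^D(f)g+s_n^D(f)\partial_n^D(g)$ for all $f,g$. The ring of spin type D symmetric polynomials is ${}^{D}\Lambda_n^-=\bigcap_{i=1}^{n-1}\ker(\partial_i^-)\cap\ker(\partial_n^D)$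 (equivalently the intersection of the images of these operators). The spin type D elementary symmetric functions are ${}^{D}\varepsilon_k^-=\sum_{1\le i_1<\dots<i_k\le n}x_{i_1}^2\cdots x_{i_k}^2$ for $1\le k\le n-1$, and ${}^{D}\varepsilon_n^-=x_1x_2\cdots x_n$. *)

theory Defs
  imports "HOL-Algebra.QuotRing" "HOL-Algebra.Subrings" "HOL-Library.Poly_Mapping"
begin

text \<open>
  The free unital ring on \<open>x\<^sub>1, \<dots>, x\<^sub>n\<close> is the monoid ring over the
  integers of the words in the letters \<open>1, \<dots>, n\<close>. The word monoid is written additively because
  multiplication of \<open>poly_mapping\<close> is convolution along \<open>+\<close>. A separate type of words
  keeps the additive structure off the type of lists.
\<close>

datatype free_word = Word (letters: "nat list")

instantiation free_word :: monoid_add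
begin

definition zero_free_word_def: "0 = Word []"

definition plus_free_word_def: "v + w = Word (letters v @ letters w)"

instance
  by standard (simp_all add: zero_free_word_def plus_free_word_def)

end

definition free_ring :: "nat \<Rightarrow> (free_word \<Rightarrow>\<^sub>0 int) ring" where
  "free_ring n =
     \<lparr>carrier = {p. \<forall>w\<in>Poly_Mapping.keys p. set (letters w) \<subseteq> {1..n}},
      monoid.mult = (*), one = 1, ring.zero = 0, add = (+)\<rparr>"

definition free_var :: "nat \<Rightarrow> (free_word \<Rightarrow>\<^sub>0 int)" where
  "free_var i = Poly_Mapping.single (Word [i]) 1"

lemma free_var_closed: "i \<in> {1..n} \<Longrightarrow> free_var i \<in> carrier (free_ring n)"
  by (simp add: free_var_def free_ring_def)

lemma ring_free_ring: "ring (free_ring n)"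
proof (rule ringI)
  show "abelian_group (free_ring n)"
  proof (rule abelian_groupI)
    fix p assume p: "p \<in> carrier (free_ring n)"
    show "\<exists>q\<in>carrier (free_ring n). q \<oplus>\<^bsub>free_ring n\<^esub> p = \<zero>\<^bsub>free_ring n\<^esub>"
      using p by (intro bexI[of _ "- p"]) (auto simp: free_ring_def in_keys_iff)
  qed (use Poly_Mapping.keys_add in \<open>fastforce simp: free_ring_def add_ac\<close>)+
  show "Group.monoid (free_ring n)"
  proof (rule monoidI)
    fix p q assume "p \<in> carrier (free_ring n)" "q \<in> carrier (free_ring n)"
    then show "p \<otimes>\<^bsub>free_ring n\<^esub> q \<in> carrier (free_ring n)"
      using keys_mult[of p q] by (fastforce simp: free_ring_def plus_free_word_def)
  qed (auto simp: free_ring_def mult.assoc zero_free_word_def)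
qed (auto simp: free_ring_def algebra_simps)

text \<open>The ideals of \<open>HOL-Algebra\<close> are two-sided.\<close>

definition Pol_ideal :: "nat \<Rightarrow> (free_word \<Rightarrow>\<^sub>0 int) set" where
  "Pol_ideal n = genideal (free_ring n)
     {free_var i * free_var j + free_var j * free_var i | i j.
        i \<in> {1..n} \<and> j \<in> {1..n} \<and> i \<noteq> j}"

definition Pol :: "nat \<Rightarrow> (free_word \<Rightarrow>\<^sub>0 int) set ring" where
  "Pol n = free_ring n Quot Pol_ideal n"

definition Pol_var :: "nat \<Rightarrow> nat \<Rightarrow> (free_word \<Rightarrow>\<^sub>0 int) set" where
  "Pol_var n i = Pol_ideal n +>\<^bsub>free_ring n\<^esub> free_var i"

lemma ring_Pol: "ring (Pol n)"
proof -
  interpret ring "free_ring n" by (rule ring_free_ring)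
  have "{free_var i * free_var j + free_var j * free_var i | i j.
           i \<in> {1..n} \<and> j \<in> {1..n} \<and> i \<noteq> j} \<subseteq> carrier (free_ring n)"
  proof clarify
    fix i j assume "i \<in> {1..n}" "j \<in> {1..n}"
    then have "free_var i \<otimes>\<^bsub>free_ring n\<^esub> free_var j \<oplus>\<^bsub>free_ring n\<^esub>
        free_var j \<otimes>\<^bsub>free_ring n\<^esub> free_var i \<in> carrier (free_ring n)"
      by (intro a_closed m_closed free_var_closed)
    then show "free_var i * free_var j + free_var j * free_var i \<in> carrier (free_ring n)"
      by (simp add: free_ring_def)
  qed
  then have "ideal (Pol_ideal n) (free_ring n)"
    unfolding Pol_ideal_def by (rule genideal_ideal)
  then show ?thesis
    unfolding Pol_def by (rule ideal.quotient_is_ring)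
qed

text \<open>
  The maps \<open>s\<^sub>i\<close>, \<open>s\<^sub>n\<^sup>D\<close> and the Demazure operators are the unique maps with their
  defining properties. Restricting to extensional functions, which are \<open>undefined\<close> outside
  the carrier, makes them unique as HOL functions.
\<close>

definition s_map :: "nat \<Rightarrow> nat \<Rightarrow> (free_word \<Rightarrow>\<^sub>0 int) set \<Rightarrow> (free_word \<Rightarrow>\<^sub>0 int) set" where
  "s_map n i = (THE s. s \<in> ring_hom (Pol n) (Pol n) \<and> s \<in> extensional (carrier (Pol n)) \<and>
     s (Pol_var n i) = \<ominus>\<^bsub>Pol n\<^esub> Pol_var n (i + 1) \<and>
     s (Pol_var n (i + 1)) = \<ominus>\<^bsub>Pol n\<^esub> Pol_var n i \<and>
     (\<forall>j\<in>{1..n} - {i, i + 1}. s (Pol_var n j) = \<ominus>\<^bsub>Pol n\<^esub> Pol_var n j))"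

definition sD_map :: "nat \<Rightarrow> (free_word \<Rightarrow>\<^sub>0 int) set \<Rightarrow> (free_word \<Rightarrow>\<^sub>0 int) set" where
  "sD_map n = (THE s. s \<in> ring_hom (Pol n) (Pol n) \<and> s \<in> extensional (carrier (Pol n)) \<and>
     s (Pol_var n n) = Pol_var n (n - 1) \<and>
     s (Pol_var n (n - 1)) = Pol_var n n \<and>
     (\<forall>j\<in>{1..n - 2}. s (Pol_var n j) = \<ominus>\<^bsub>Pol n\<^esub> Pol_var n j))"

text \<open>For a map between abelian groups, additive and \<open>\<int>\<close>-linear are the same.\<close>

definition twisted_derivation ::
    "('a, 'm) ring_scheme \<Rightarrow> ('a \<Rightarrow> 'a) \<Rightarrow> ('a \<Rightarrow> 'a) \<Rightarrow> bool" where
  "twisted_derivation R s d \<longleftrightarrow>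
     d \<in> hom (add_monoid R) (add_monoid R) \<and> d \<one>\<^bsub>R\<^esub> = \<zero>\<^bsub>R\<^esub> \<and>
     (\<forall>f\<in>carrier R. \<forall>g\<in>carrier R.
        d (f \<otimes>\<^bsub>R\<^esub> g) = d f \<otimes>\<^bsub>R\<^esub> g \<oplus>\<^bsub>R\<^esub> s f \<otimes>\<^bsub>R\<^esub> d g)"

definition demazure :: "nat \<Rightarrow> nat \<Rightarrow> (free_word \<Rightarrow>\<^sub>0 int) set \<Rightarrow> (free_word \<Rightarrow>\<^sub>0 int) set" where
  "demazure n i = (THE d. twisted_derivation (Pol n) (s_map n i) d \<and>
     d \<in> extensional (carrier (Pol n)) \<and>
     (\<forall>j\<in>{1..n}. d (Pol_var n j) = (if j \<in> {i, i + 1} then \<one>\<^bsub>Pol n\<^esub> else \<zero>\<^bsub>Pol n\<^esub>)))"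

definition demazureD :: "nat \<Rightarrow> (free_word \<Rightarrow>\<^sub>0 int) set \<Rightarrow> (free_word \<Rightarrow>\<^sub>0 int) set" where
  "demazureD n = (THE d. twisted_derivation (Pol n) (sD_map n) d \<and>
     d \<in> extensional (carrier (Pol n)) \<and>
     d (Pol_var n n) = \<ominus>\<^bsub>Pol n\<^esub> \<one>\<^bsub>Pol n\<^esub> \<and>
     d (Pol_var n (n - 1)) = \<one>\<^bsub>Pol n\<^esub> \<and>
     (\<forall>j\<in>{1..n - 2}. d (Pol_var n j) = \<zero>\<^bsub>Pol n\<^esub>))"

definition LambdaD :: "nat \<Rightarrow> (free_word \<Rightarrow>\<^sub>0 int) set set" where
  "LambdaD n = (\<Inter>i\<in>{1..n - 1}. a_kernel (Pol n) (Pol n) (demazure n i)) \<inter>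
     a_kernel (Pol n) (Pol n) (demazureD n)"

text \<open>\<open>Pol n\<close> is not commutative, so products are taken along lists, from left to right.\<close>

definition list_prod :: "('a, 'm) ring_scheme \<Rightarrow> 'a list \<Rightarrow> 'a" where
  "list_prod R xs = foldr (\<otimes>\<^bsub>R\<^esub>) xs \<one>\<^bsub>R\<^esub>"

definition epsD :: "nat \<Rightarrow> nat \<Rightarrow> (free_word \<Rightarrow>\<^sub>0 int) set" where
  "epsD n k =
     (if k < n then
        (\<Oplus>\<^bsub>Pol n\<^esub>I\<in>{I. I \<subseteq> {1..n} \<and> card I = k}.
           list_prod (Pol n) (map (\<lambda>i. Pol_var n i [^]\<^bsub>Pol n\<^esub> (2::nat)) (sorted_list_of_set I)))
      else list_prod (Pol n) (map (Pol_var n) [1..<n + 1]))"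

text \<open>
  The commutative polynomial ring over the integers in \<open>y\<^sub>1, \<dots>, y\<^sub>n\<close>; a monomial is
  its finitely supported exponent function.
\<close>

definition int_poly_ring :: "nat \<Rightarrow> ((nat \<Rightarrow>\<^sub>0 nat) \<Rightarrow>\<^sub>0 int) ring" where
  "int_poly_ring n =
     \<lparr>carrier = {p. \<forall>m\<in>Poly_Mapping.keys p. Poly_Mapping.keys m \<subseteq> {1..n}},
      monoid.mult = (*), one = 1, ring.zero = 0, add = (+)\<rparr>"

definition int_poly_var :: "nat \<Rightarrow> ((nat \<Rightarrow>\<^sub>0 nat) \<Rightarrow>\<^sub>0 int)" where
  "int_poly_var k = Poly_Mapping.single (Poly_Mapping.single k 1) 1"

text \<open>
  A subset \<open>A\<close> of the ring \<open>R\<close> is a polynomial algebra over \<open>\<int>\<close> generated by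
  \<open>e 1, \<dots>, e n\<close>: it is a subring, and sending each variable \<open>y\<^sub>k\<close> to \<open>e k\<close> defines
  an isomorphism from the polynomial ring onto it.
\<close>

definition polynomial_algebra_generated_by ::
    "('a, 'm) ring_scheme \<Rightarrow> 'a set \<Rightarrow> nat \<Rightarrow> (nat \<Rightarrow> 'a) \<Rightarrow> bool" where
  "polynomial_algebra_generated_by R A n e \<longleftrightarrow>
     subring A R \<and>
     (\<exists>\<phi>\<in>ring_iso (int_poly_ring n) (R\<lparr>carrier := A\<rparr>). \<forall>k\<in>{1..n}. \<phi> (int_poly_var k) = e k)"

end

theory Submission
  imports Defs "HOL-Combinatorics.Transposition"
begin

text \<open>
  The squares \<open>x\<^sub>i\<^sup>2\<close> are central in the ring of skew polynomials, and the ring has no zero divisors.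
  Both facts are used to recognise every Demazure operator as a divided difference. Put
  \<open>a = x\<^sub>i + \<theta> x\<^bsub>i+1\<^esub>\<close>, where \<open>\<theta> = -1\<close> for \<open>\<partial>\<^sub>i\<close> and where \<open>\<theta> = 1\<close>, \<open>i = n - 1\<close> for the extra operator of
  type D, and let \<open>s\<close> be the endomorphism that twists the operator \<open>\<partial>\<close>. Then
  \<open>(x\<^sub>i\<^sup>2 - x\<^bsub>i+1\<^esub>\<^sup>2) \<partial> f = a f - s(f) a\<close>, because both sides are twisted derivations that agree on the
  variables. This proves that the operators exist, and it turns \<open>\<partial> f = 0\<close> into the linear equation
  \<open>a f = s(f) a\<close> (\<open>swap_quotient_eq_0_iff\<close>).

  That equation only relates coefficients of monomials that differ in the exponents \<open>u\<close>, \<open>v\<close> of \<open>x\<^sub>i\<close> and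
  \<open>x\<^bsub>i+1\<^esub>\<close> (\<open>swap_fixed_iff\<close>). Where \<open>u + v\<close> is even, the equation of \<open>\<partial>\<^sub>i\<close> says that the
  coefficient is symmetric in \<open>u\<close> and \<open>v\<close>. Where \<open>u + v\<close> is odd, the equations of \<open>\<partial>\<^bsub>n-1\<^esub>\<close> and of the
  type D operator, added and subtracted, move a coefficient along a staircase \<open>(u, v), (v - 1, u + 1), (u + 2, v - 2), \<dots>\<close> until it
  leaves the quadrant, so it is zero. For smaller \<open>i\<close> there is a single equation, but the exponents of
  \<open>x\<^bsub>i+1\<^esub>\<close> and \<open>x\<^bsub>i+2\<^esub>\<close> are already known to have equal parity; this removes half of the unknowns and the
  staircase works again. Hence the common kernel consists of the \<open>f\<close> whose coefficients are symmetric and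
  whose monomials have exponents of one parity (\<open>typeD_symmetric_iff_swap_fixed\<close>): it is
  \<open>S \<oplus> S x\<^sub>1\<cdots>x\<^sub>n\<close> with \<open>S\<close> the symmetric polynomials in the squares.

  From here on the argument is Gauss's proof of the fundamental theorem on symmetric polynomials. The
  generators commute, their lexicographically leading coefficients are units, and the leading exponents
  of the products \<open>\<epsilon>\<^sub>1\<^bsup>\<mu>1\<^esup> \<cdots> \<epsilon>\<^sub>n\<^bsup>\<mu>n\<^esup>\<close> run exactly once through the weakly decreasing sequences of
  constant parity (\<open>leading_exps_inj\<close>, \<open>leading_exps_surj\<close>). These sequences are the possible leading
  exponents of elements of the kernel, so subtracting leading terms expresses every such element, and
  distinct leading exponents give algebraic independence.

  All computations take place in a concrete model, the free abelian group on the exponent functions with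
  a product twisted by signs. Sorting the letters of a word shows that the model restricted to
  \<open>x\<^sub>1, \<dots>, x\<^sub>n\<close> is the quotient of the free ring by the anticommutation relations (\<open>to_skew_iso\<close>).
\<close>

section \<open>The ring of skew polynomials\<close>

type_synonym exps = "nat \<Rightarrow>\<^sub>0 nat"

abbreviation expo :: "exps \<Rightarrow> nat \<Rightarrow> nat" where
  "expo \<equiv> Poly_Mapping.lookup"

text \<open>
  All exponents of signs below are linear in the exponents of a monomial, or bilinear in those of two
  monomials. Expressing them by weights reduces each sign identity to an identity of weight functions.
\<close>

definition weight :: "(nat \<Rightarrow> nat) \<Rightarrow> exps \<Rightarrow> nat" where
  "weight w a = (\<Sum>k\<in>Poly_Mapping.keys a. expo a k * w k)"

lemma weight_superset:
  assumes "finite K" "Poly_Mapping.keys a \<subseteq> K"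
  shows "weight w a = (\<Sum>k\<in>K. expo a k * w k)"
  unfolding weight_def
  by (rule sum.mono_neutral_left) (use assms in \<open>auto simp: in_keys_iff\<close>)

lemma weight_add: "weight w (a + b) = weight w a + weight w b"
proof -
  let ?K = "Poly_Mapping.keys a \<union> Poly_Mapping.keys b"
  have "weight w (a + b) = (\<Sum>k\<in>?K. expo (a + b) k * w k)"
    by (rule weight_superset) (use Poly_Mapping.keys_add[of a b] in auto)
  also have "\<dots> = (\<Sum>k\<in>?K. expo a k * w k) + (\<Sum>k\<in>?K. expo b k * w k)"
    by (simp add: lookup_add algebra_simps sum.distrib)
  finally show ?thesis by (simp add: weight_superset[of ?K])
qed

lemma weight_zero [simp]: "weight w 0 = 0"
  by (simp add: weight_def)

lemma weight_single [simp]: "weight w (Poly_Mapping.single k c) = c * w k"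
  by (simp add: weight_def)

lemma weight_add_fun: "weight (\<lambda>k. v k + w k) a = weight v a + weight w a"
  by (simp add: weight_def algebra_simps sum.distrib)

lemma weight_mult_fun: "weight (\<lambda>k. c * w k) a = c * weight w a"
  by (simp add: weight_def algebra_simps sum_distrib_left)

lemma weight_indicator: "weight (\<lambda>k. of_bool (k = i)) a = expo a i"
  by (cases "i \<in> Poly_Mapping.keys a") (auto simp: weight_def in_keys_iff of_bool_def if_distrib cong: if_cong)

text \<open>
  The number of transpositions of distinct letters that sort the product of two sorted words: a letter
  \<open>i\<close> of the left factor has to pass each smaller letter \<open>j\<close> of the right factor.
\<close>

definition inversions :: "exps \<Rightarrow> exps \<Rightarrow> nat" where
  "inversions a b = weight (\<lambda>i. weight (\<lambda>j. of_bool (j < i)) b) a"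

lemma inversions_add_left: "inversions (a + a') b = inversions a b + inversions a' b"
  by (simp add: inversions_def weight_add)

lemma inversions_add_right: "inversions a (b + b') = inversions a b + inversions a b'"
  by (simp add: inversions_def weight_add weight_add_fun)

lemma inversions_zero [simp]: "inversions 0 b = 0" "inversions a 0 = 0"
  by (simp_all add: inversions_def weight_def)

definition reorder_sign :: "exps \<Rightarrow> exps \<Rightarrow> int" where
  "reorder_sign a b = (- 1) ^ inversions a b"

lemma reorder_sign_zero [simp]: "reorder_sign 0 b = 1" "reorder_sign a 0 = 1"
  by (simp_all add: reorder_sign_def)

lemma reorder_sign_neq_0 [simp]: "reorder_sign a b \<noteq> 0"
  by (simp add: reorder_sign_def)

lemma reorder_sign_abs: "\<bar>reorder_sign a b\<bar> = 1"
  by (simp add: reorder_sign_def power_abs)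

definition twisted_conv :: "(exps \<Rightarrow>\<^sub>0 int) \<Rightarrow> (exps \<Rightarrow>\<^sub>0 int) \<Rightarrow> (exps \<Rightarrow>\<^sub>0 int)" where
  "twisted_conv p q =
     frag_extend (\<lambda>a. frag_extend (\<lambda>b. frag_cmul (reorder_sign a b) (frag_of (a + b))) q) p"

lemma twisted_conv_of:
  "twisted_conv (frag_of a) (frag_of b) = frag_cmul (reorder_sign a b) (frag_of (a + b))"
  by (simp add: twisted_conv_def)

lemma twisted_conv_diff_left: "twisted_conv (p - p') q = twisted_conv p q - twisted_conv p' q"
  by (simp add: twisted_conv_def frag_extend_diff)

lemma twisted_conv_diff_right: "twisted_conv p (q - q') = twisted_conv p q - twisted_conv p q'"
  using subset_UNIV
  by (induction p rule: frag_induction) (auto simp: twisted_conv_def frag_extend_diff)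

lemma twisted_conv_zero [simp]: "twisted_conv 0 q = 0" "twisted_conv p 0 = 0"
  using twisted_conv_diff_left[of 0 0 q] twisted_conv_diff_right[of p 0 0] by simp_all

lemma twisted_conv_add:
  "twisted_conv (p + p') q = twisted_conv p q + twisted_conv p' q"
  "twisted_conv p (q + q') = twisted_conv p q + twisted_conv p q'"
proof -
  have "twisted_conv (p - (0 - p')) q = twisted_conv p q + twisted_conv p' q"
    unfolding twisted_conv_diff_left by simp
  then show "twisted_conv (p + p') q = twisted_conv p q + twisted_conv p' q" by simp
  have "twisted_conv p (q - (0 - q')) = twisted_conv p q + twisted_conv p q'"
    unfolding twisted_conv_diff_right by simp
  then show "twisted_conv p (q + q') = twisted_conv p q + twisted_conv p q'" by simp
qed

lemma twisted_conv_cmul: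
  "twisted_conv (frag_cmul c p) q = frag_cmul c (twisted_conv p q)"
  "twisted_conv p (frag_cmul c q) = frag_cmul c (twisted_conv p q)"
proof -
  show "twisted_conv (frag_cmul c p) q = frag_cmul c (twisted_conv p q)"
    by (simp add: twisted_conv_def frag_extend_cmul)
  show "twisted_conv p (frag_cmul c q) = frag_cmul c (twisted_conv p q)"
    using subset_UNIV
  proof (induction p rule: frag_induction)
    case (one a)
    then show ?case by (simp add: twisted_conv_def frag_extend_cmul)
  next
    case (diff a b)
    then show ?case
      using frag_cmul_distrib2[of c "twisted_conv (a - b) q" "twisted_conv b q"]
      by (simp add: twisted_conv_diff_left algebra_simps)
  qed simp
qed

text \<open>
  By trilinearity only monomials matter, and there associativity is the cocycle identity of the sign,
  which holds because the number of inversions is additive in both arguments.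
\<close>

lemma twisted_conv_assoc:
  "twisted_conv (twisted_conv p q) r = twisted_conv p (twisted_conv q r)"
  using subset_UNIV
proof (induction p rule: frag_induction)
  case (one a)
  show ?case using subset_UNIV
  proof (induction q rule: frag_induction)
    case (one b)
    show ?case using subset_UNIV
    proof (induction r rule: frag_induction)
      case (one c)
      have "reorder_sign a b * reorder_sign (a + b) c = reorder_sign a (b + c) * reorder_sign b c"
        by (simp add: reorder_sign_def inversions_add_left inversions_add_right flip: power_add)
          (simp add: algebra_simps)
      then show ?case
        by (simp add: twisted_conv_of twisted_conv_cmul add.assoc mult.commute)
    qed (simp_all add: twisted_conv_diff_right)
  qed (simp_all add: twisted_conv_diff_right twisted_conv_diff_left)
qed (simp_all add: twisted_conv_diff_left)

lemma twisted_conv_one [simp]: "twisted_conv 1 q = q" "twisted_conv p 1 = p"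
proof -
  have "twisted_conv (frag_of 0) q = q" "twisted_conv p (frag_of 0) = p"
    unfolding twisted_conv_def frag_extend_of by (simp_all flip: frag_expansion)
  then show "twisted_conv 1 q = q" "twisted_conv p 1 = p" by simp_all
qed

text \<open>
  The type is wrapped since the type of finitely supported functions already carries the untwisted
  convolution product.
\<close>

datatype skew_poly = Skew (coeffs: "exps \<Rightarrow>\<^sub>0 int")

instantiation skew_poly :: ring_1
begin

definition zero_skew_poly_def: "0 = Skew 0"
definition one_skew_poly_def: "1 = Skew 1"
definition plus_skew_poly_def: "f + g = Skew (coeffs f + coeffs g)"
definition minus_skew_poly_def: "f - g = Skew (coeffs f - coeffs g)"
definition uminus_skew_poly_def: "- f = Skew (- coeffs f)"
definition times_skew_poly_def: "f * g = Skew (twisted_conv (coeffs f) (coeffs g))"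

instance
  by standard
    (simp_all add: zero_skew_poly_def one_skew_poly_def plus_skew_poly_def minus_skew_poly_def
      uminus_skew_poly_def times_skew_poly_def twisted_conv_assoc twisted_conv_one
      twisted_conv_add algebra_simps skew_poly.expand)

end

abbreviation coeff :: "skew_poly \<Rightarrow> exps \<Rightarrow> int" where
  "coeff f \<equiv> Poly_Mapping.lookup (coeffs f)"

abbreviation support :: "skew_poly \<Rightarrow> exps set" where
  "support f \<equiv> Poly_Mapping.keys (coeffs f)"

definition monom :: "exps \<Rightarrow> skew_poly" where
  "monom a = Skew (frag_of a)"

definition X :: "nat \<Rightarrow> skew_poly" where
  "X i = monom (Poly_Mapping.single i 1)"

lemma skew_poly_eqI: "(\<And>m. coeff f m = coeff g m) \<Longrightarrow> f = g"
  by (simp add: skew_poly.expand poly_mapping_eqI)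

lemma coeff_simps [simp]:
  "coeff 0 m = 0" "coeff (f + g) m = coeff f m + coeff g m" "coeff (f - g) m = coeff f m - coeff g m"
  "coeff (- f) m = - coeff f m"
  by (simp_all add: zero_skew_poly_def plus_skew_poly_def minus_skew_poly_def uminus_skew_poly_def
    lookup_add lookup_minus)

lemma coeff_monom: "coeff (monom a) m = of_bool (m = a)"
  by (auto simp: monom_def lookup_single when_def)

lemma monom_zero: "monom 0 = 1"
  by (simp add: monom_def one_skew_poly_def)

lemma coeffs_of_int: "coeffs (of_int c) = frag_cmul c 1"
proof -
  have nat: "coeffs (of_nat k) = frag_cmul (int k) 1" for k
    by (induction k)
      (simp_all add: zero_skew_poly_def one_skew_poly_def plus_skew_poly_def frag_cmul_distrib)
  show ?thesis
    by (cases c rule: int_diff_cases)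
      (simp add: nat minus_skew_poly_def frag_cmul_diff_distrib)
qed

lemma coeffs_of_int_mult: "coeffs (of_int c * f) = frag_cmul c (coeffs f)"
  by (simp add: times_skew_poly_def coeffs_of_int twisted_conv_cmul twisted_conv_one)

lemma coeff_of_int_mult [simp]: "coeff (of_int c * f) m = c * coeff f m"
  by (simp add: coeffs_of_int_mult)

lemma monom_mult: "monom a * monom b = of_int (reorder_sign a b) * monom (a + b)"
  by (rule skew_poly.expand) (simp add: coeffs_of_int_mult, simp add: times_skew_poly_def monom_def twisted_conv_of)

lemma coeff_mult:
  "coeff (f * g) c =
     (\<Sum>a\<in>support f. \<Sum>b\<in>support g. coeff f a * coeff g b * reorder_sign a b * of_bool (a + b = c))"
  by (simp add: times_skew_poly_def twisted_conv_def frag_extend_def lookup_sum sum_distrib_left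
      lookup_single when_def of_bool_def mult.assoc if_distrib eq_commute[of c] cong: if_cong)

lemma support_mult: "m \<in> support (f * g) \<Longrightarrow> \<exists>a\<in>support f. \<exists>b\<in>support g. m = a + b"
proof (rule ccontr)
  assume "m \<in> support (f * g)" and no: "\<not> (\<exists>a\<in>support f. \<exists>b\<in>support g. m = a + b)"
  have "coeff (f * g) m = 0"
    unfolding coeff_mult by (intro sum.neutral ballI) (use no in \<open>auto simp: of_bool_def\<close>)
  then show False using \<open>m \<in> support (f * g)\<close> by (simp add: in_keys_iff)
qed

text \<open>
  If \<open>a + b = m + k\<close> with \<open>a \<le> m\<close> and \<open>b \<le> k\<close>, then \<open>a = m\<close> and \<open>b = k\<close>, as the lexicographic order is
  compatible with addition. So leading monomials multiply without cancellation. This also gives the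
  absence of zero divisors.
\<close>

lemma coeff_mult_leading:
  assumes f: "\<And>a. a \<in> support f \<Longrightarrow> a \<le> m" and g: "\<And>b. b \<in> support g \<Longrightarrow> b \<le> k"
  shows "coeff (f * g) (m + k) = coeff f m * coeff g k * reorder_sign m k"
proof -
  have "a = m \<and> b = k" if "a \<in> support f" "b \<in> support g" "a + b = m + k" for a b
  proof -
    have "a \<le> m" "b \<le> k" using f g that by auto
    moreover have "\<not> a < m" using that(3) \<open>b \<le> k\<close> add_less_le_mono[of a m b k] by auto
    ultimately show ?thesis using that(3) by auto
  qed
  then have "coeff (f * g) (m + k) =
      (\<Sum>a\<in>support f. \<Sum>b\<in>support g. if a = m then (if b = k then coeff f m * coeff g k * reorder_sign m k else 0) else 0)"
    unfolding coeff_mult by (intro sum.cong refl) (auto simp: of_bool_def)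
  also have "\<dots> = (\<Sum>a\<in>support f. if a = m then (\<Sum>b\<in>support g. if b = k then coeff f m * coeff g k * reorder_sign m k else 0) else 0)"
    by (intro sum.cong refl) auto
  also have "\<dots> = coeff f m * coeff g k * reorder_sign m k"
    by (simp add: in_keys_iff)
  finally show ?thesis .
qed

lemma support_empty_iff: "support f = {} \<longleftrightarrow> f = 0"
  by (cases f) (simp add: zero_skew_poly_def)

instance skew_poly :: ring_1_no_zero_divisors
proof
  fix f g :: skew_poly assume "f \<noteq> 0" "g \<noteq> 0"
  then have ne: "support f \<noteq> {}" "support g \<noteq> {}" unfolding support_empty_iff by simp_all
  have "coeff (f * g) (Max (support f) + Max (support g)) =
      coeff f (Max (support f)) * coeff g (Max (support g)) * reorder_sign (Max (support f)) (Max (support g))"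
    by (rule coeff_mult_leading) simp_all
  moreover have "coeff f (Max (support f)) \<noteq> 0" "coeff g (Max (support g)) \<noteq> 0"
    using Max_in[OF _ ne(1)] Max_in[OF _ ne(2)] by (simp_all add: in_keys_iff)
  ultimately show "f * g \<noteq> 0" by auto
qed

lemma skew_poly_induct [consumes 1, case_names zero monom diff]:
  assumes "support f \<subseteq> S" "P 0" "\<And>a. a \<in> S \<Longrightarrow> P (monom a)"
    and diff: "\<And>f g. P f \<Longrightarrow> P g \<Longrightarrow> P (f - g)"
  shows "P f"
proof -
  have "P (Skew p)" if "Poly_Mapping.keys p \<subseteq> S" for p
    using that
  proof (induction p rule: frag_induction)
    case (diff p q)
    then show ?case using assms(4)[of "Skew p" "Skew q"] by (simp add: minus_skew_poly_def)
  qed (use assms in \<open>simp_all add: zero_skew_poly_def monom_def\<close>)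
  from this[of "coeffs f"] show ?thesis using assms(1) by simp
qed

section \<open>The endomorphisms that exchange two neighbouring variables\<close>

definition swap :: "nat \<Rightarrow> exps \<Rightarrow> exps" where
  "swap i m = Poly_Mapping.map_key (transpose i (Suc i)) m"

lemma expo_swap [simp]: "expo (swap i m) k = expo m (transpose i (Suc i) k)"
  by (simp add: swap_def map_key.rep_eq)

lemma swap_swap [simp]: "swap i (swap i m) = m"
  by (rule poly_mapping_eqI) simp

lemma swap_add: "swap i (a + b) = swap i a + swap i b"
  by (rule poly_mapping_eqI) (simp add: lookup_add)

lemma swap_zero [simp]: "swap i 0 = 0"
  by (rule poly_mapping_eqI) simp

lemma swap_single: "swap i (Poly_Mapping.single k c) = Poly_Mapping.single (transpose i (Suc i) k) c"
  by (rule poly_mapping_eqI) (auto simp: lookup_single when_def transpose_def)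

lemma swap_eq_iff: "swap i a = b \<longleftrightarrow> a = swap i b"
  by auto

lemma weight_swap: "weight w (swap i m) = weight (\<lambda>k. w (transpose i (Suc i) k)) m"
  unfolding weight_def
  by (rule sum.reindex_bij_witness[where i = "transpose i (Suc i)" and j = "transpose i (Suc i)"])
    (auto simp: in_keys_iff)

text \<open>
  Exchanging the letters \<open>i\<close> and \<open>i + 1\<close> changes the order of these two letters only: the inversions
  between a letter \<open>i + 1\<close> on the left and a letter \<open>i\<close> on the right are lost, those between \<open>i\<close> on the left
  and \<open>i + 1\<close> on the right are gained.
\<close>

lemma inversions_swap:
  "inversions (swap i a) (swap i b) + expo a (Suc i) * expo b i =
   inversions a b + expo a i * expo b (Suc i)"
proof -
  have ind: "weight (\<lambda>j. c * of_bool (j = l)) m = c * expo m l" for c l m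
    by (simp add: weight_mult_fun weight_indicator)
  let ?\<tau> = "transpose i (Suc i)"
  have pointwise: "of_bool (?\<tau> j < ?\<tau> k) + of_bool (k = Suc i) * of_bool (j = i) =
      of_bool (j < k) + (of_bool (k = i) * of_bool (j = Suc i) :: nat)" for j k
    by (auto simp: transpose_def)
  have inner: "weight (\<lambda>j. of_bool (?\<tau> j < ?\<tau> k)) b + expo b i * of_bool (k = Suc i) =
      weight (\<lambda>j. of_bool (j < k)) b + expo b (Suc i) * of_bool (k = i)" for k
  proof -
    have "weight (\<lambda>j. of_bool (?\<tau> j < ?\<tau> k) + of_bool (k = Suc i) * of_bool (j = i)) b =
        weight (\<lambda>j. of_bool (j < k) + of_bool (k = i) * of_bool (j = Suc i)) b"
      by (simp only: pointwise)
    then show ?thesis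
      by (simp only: weight_add_fun ind) (simp only: mult.commute)
  qed
  have "weight (\<lambda>k. weight (\<lambda>j. of_bool (?\<tau> j < ?\<tau> k)) b + expo b i * of_bool (k = Suc i)) a =
      weight (\<lambda>k. weight (\<lambda>j. of_bool (j < k)) b + expo b (Suc i) * of_bool (k = i)) a"
    by (simp only: inner)
  then show ?thesis
    by (simp add: inversions_def weight_swap weight_add_fun ind mult.commute)
qed

text \<open>
  The sign of the image of \<open>x\<^sup>a\<close> when \<open>x\<^sub>i\<close> and \<open>x\<^bsub>i+1\<^esub>\<close> are exchanged with a factor \<open>(-1)\<^sup>e\<close> and every other
  variable is negated. The product \<open>a\<^sub>i a\<^bsub>i+1\<^esub>\<close> counts the transpositions that sort the image again.
\<close>

definition swap_sign :: "nat \<Rightarrow> nat \<Rightarrow> exps \<Rightarrow> int" where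
  "swap_sign i e a =
     (- 1) ^ (weight (\<lambda>j. if j \<in> {i, Suc i} then e else 1) a + expo a i * expo a (Suc i))"

lemma swap_sign_swap [simp]: "swap_sign i e (swap i a) = swap_sign i e a"
proof -
  have "(\<lambda>k. if transpose i (Suc i) k \<in> {i, Suc i} then e else 1) = (\<lambda>j. if j \<in> {i, Suc i} then e else 1)"
    by (auto simp: transpose_def)
  then show ?thesis by (simp only: swap_sign_def weight_swap expo_swap) (simp add: mult.commute)
qed

text \<open>
  For \<open>e = 1\<close> this is the map \<open>s\<^sub>i\<close>; for \<open>e = 0\<close> and \<open>i = n - 1\<close> it is \<open>s\<^sub>n\<^sup>D\<close>. Treating both as one family
  lets the two types of operators share all computations.
\<close>

definition swap_hom :: "nat \<Rightarrow> nat \<Rightarrow> skew_poly \<Rightarrow> skew_poly" where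
  "swap_hom i e f =
     Skew (frag_extend (\<lambda>a. frag_cmul (swap_sign i e a) (frag_of (swap i a))) (coeffs f))"

lemma swap_hom_monom: "swap_hom i e (monom a) = of_int (swap_sign i e a) * monom (swap i a)"
  by (rule skew_poly.expand) (simp add: coeffs_of_int_mult, simp add: swap_hom_def monom_def)

lemma swap_hom_diff: "swap_hom i e (f - g) = swap_hom i e f - swap_hom i e g"
  by (simp add: swap_hom_def frag_extend_diff minus_skew_poly_def)

lemma swap_hom_add: "swap_hom i e (f + g) = swap_hom i e f + swap_hom i e g"
  by (simp add: swap_hom_def frag_extend_add plus_skew_poly_def)

lemma swap_hom_zero [simp]: "swap_hom i e 0 = 0"
  using swap_hom_diff[of i e 0 0] by simp

lemma swap_hom_one [simp]: "swap_hom i e 1 = 1"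
  using swap_hom_monom[of i e 0] by (simp add: monom_zero swap_sign_def)

lemma swap_hom_of_int_mult: "swap_hom i e (of_int c * f) = of_int c * swap_hom i e f"
  by (rule skew_poly.expand) (simp add: coeffs_of_int_mult, simp add: swap_hom_def coeffs_of_int_mult frag_extend_cmul)

lemma coeff_swap_hom: "coeff (swap_hom i e f) m = swap_sign i e m * coeff f (swap i m)"
  using subset_UNIV
proof (induction f rule: skew_poly_induct)
  case (monom a)
  then show ?case by (auto simp: swap_hom_monom coeff_monom swap_eq_iff)
qed (auto simp: swap_hom_diff algebra_simps)

lemma of_int_mult_product:
  fixes x y :: skew_poly
  shows "(of_int c * x) * (of_int d * y) = of_int (c * d) * (x * y)"
  by (metis (no_types) mult.assoc mult_of_int_commute of_int_mult)

lemma neg_one_power_cong: "even (a + b) \<Longrightarrow> (- 1) ^ a = ((- 1) ^ b :: int)"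
  by (simp add: minus_one_power_iff)

lemma neg_one_power_add_double: "a = b + 2 * k \<Longrightarrow> (- 1) ^ a = ((- 1) ^ b :: int)"
  by (simp add: power_add power_mult)

text \<open>
  On monomials this is a comparison of signs. The quadratic term \<open>a\<^sub>i a\<^bsub>i+1\<^esub>\<close> of the sign fails to be
  additive by \<open>a\<^sub>i b\<^bsub>i+1\<^esub> + b\<^sub>i a\<^bsub>i+1\<^esub>\<close>, which modulo 2 is the change in the number of inversions.
\<close>

lemma swap_hom_mult: "swap_hom i e (f * g) = swap_hom i e f * swap_hom i e g"
  using subset_UNIV
proof (induction f rule: skew_poly_induct)
  case (monom a)
  show ?case using subset_UNIV
  proof (induction g rule: skew_poly_induct)
    case (monom b)
    define P where "P = weight (\<lambda>j. if j \<in> {i, Suc i} then e else 1) a + expo a i * expo a (Suc i)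
        + (weight (\<lambda>j. if j \<in> {i, Suc i} then e else 1) b + expo b i * expo b (Suc i))"
    have "P + expo a i * expo b (Suc i) + expo b i * expo a (Suc i) + inversions a b
          + (P + inversions (swap i a) (swap i b)) =
        2 * (P + inversions a b + expo a i * expo b (Suc i))"
      using inversions_swap[of i a b] by (simp add: algebra_simps)
    then have "(- 1) ^ (P + expo a i * expo b (Suc i) + expo b i * expo a (Suc i) + inversions a b) =
        ((- 1) ^ (P + inversions (swap i a) (swap i b)) :: int)"
      by (intro neg_one_power_cong) (simp only: dvd_triv_left)
    then have "swap_sign i e (a + b) * reorder_sign a b =
        swap_sign i e a * swap_sign i e b * reorder_sign (swap i a) (swap i b)"
      unfolding swap_sign_def reorder_sign_def weight_add lookup_add power_add[symmetric] P_def
      by (simp add: algebra_simps)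
    then show ?case
      unfolding monom_mult swap_hom_of_int_mult swap_hom_monom swap_add of_int_mult_product
      by (simp only: mult.assoc[symmetric] of_int_mult[symmetric] mult.commute[of "reorder_sign a b"])
  qed (simp_all add: swap_hom_diff algebra_simps)
qed (simp_all add: swap_hom_diff algebra_simps)

lemma swap_hom_X:
  "swap_hom i e (X j) = of_int ((- 1) ^ (if j \<in> {i, Suc i} then e else 1)) * X (transpose i (Suc i) j)"
  by (simp add: X_def swap_hom_monom swap_single swap_sign_def lookup_single when_def)

lemma coeff_monom_mult:
  "coeff (monom a * f) (a + b) = reorder_sign a b * coeff f b"
  "coeff (f * monom a) (b + a) = reorder_sign b a * coeff f b"
proof -
  show "coeff (monom a * f) (a + b) = reorder_sign a b * coeff f b"
    using subset_UNIV
    by (induction f rule: skew_poly_induct) (auto simp: monom_mult coeff_monom left_diff_distrib right_diff_distrib)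
  have cancel: "b + a = b' + a \<longleftrightarrow> b = b'" for b' by simp
  show "coeff (f * monom a) (b + a) = reorder_sign b a * coeff f b"
    using subset_UNIV
  proof (induction f rule: skew_poly_induct)
    case (monom b')
    show ?case unfolding monom_mult coeff_of_int_mult coeff_monom cancel by (cases "b = b'") simp_all
  qed (simp_all add: left_diff_distrib right_diff_distrib)
qed

lemma coeff_monom_mult_eq_0:
  assumes "\<And>b. m \<noteq> a + b"
  shows "coeff (monom a * f) m = 0" "coeff (f * monom a) m = 0"
proof -
  have "support (monom a) = {a}" by (simp add: monom_def)
  then have "m \<notin> support (monom a * f)" "m \<notin> support (f * monom a)"
    using support_mult[of m "monom a" f] support_mult[of m f "monom a"] assms
    by (auto simp: add.commute[of _ a])
  then show "coeff (monom a * f) m = 0" "coeff (f * monom a) m = 0"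
    by (simp_all add: in_keys_iff)
qed

section \<open>Commuting with a linear form, coefficient by coefficient\<close>

text \<open>
  The exponents at \<open>i\<close> and \<open>i + 1\<close> are singled out as \<open>u\<close> and \<open>v\<close>; the remaining exponents \<open>b\<close> are
  parameters of the recurrences. The base \<open>b\<close> is meant to vanish at \<open>i\<close> and \<open>i + 1\<close>.
\<close>

definition slice_exps :: "nat \<Rightarrow> exps \<Rightarrow> nat \<Rightarrow> nat \<Rightarrow> exps" where
  "slice_exps i b u v = b + Poly_Mapping.single i u + Poly_Mapping.single (Suc i) v"

lemma expo_slice_exps: "expo (slice_exps i b u v) k =
    expo b k + (if k = i then u else if k = Suc i then v else 0)"
  by (simp add: slice_exps_def lookup_add lookup_single when_def)

lemma slice_exps_exists:
  obtains b where "expo b i = 0" "expo b (Suc i) = 0" "m = slice_exps i b (expo m i) (expo m (Suc i))"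
proof
  let ?b = "m - Poly_Mapping.single i (expo m i) - Poly_Mapping.single (Suc i) (expo m (Suc i))"
  show "expo ?b i = 0" "expo ?b (Suc i) = 0"
    by (simp_all add: lookup_minus lookup_single when_def)
  show "m = slice_exps i ?b (expo m i) (expo m (Suc i))"
    by (rule poly_mapping_eqI) (simp add: expo_slice_exps lookup_minus lookup_single when_def)
qed

lemma swap_slice_exps: "expo b i = 0 \<Longrightarrow> expo b (Suc i) = 0 \<Longrightarrow> swap i (slice_exps i b u v) = slice_exps i b v u"
  by (rule poly_mapping_eqI) (auto simp: expo_slice_exps transpose_def)

text \<open>
  Coefficients after multiplication by \<open>x\<^sub>i\<close> (and, for the second argument, by \<open>x\<^bsub>i+1\<^esub>\<close>), up to sign;
  they vanish on the boundary of the quadrant.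
\<close>

definition shift1 :: "(nat \<Rightarrow> nat \<Rightarrow> int) \<Rightarrow> nat \<Rightarrow> nat \<Rightarrow> int" where
  "shift1 F p q = (case p of 0 \<Rightarrow> 0 | Suc p' \<Rightarrow> F p' q)"

definition shift2 :: "(nat \<Rightarrow> nat \<Rightarrow> int) \<Rightarrow> nat \<Rightarrow> nat \<Rightarrow> int" where
  "shift2 F p q = (case q of 0 \<Rightarrow> 0 | Suc q' \<Rightarrow> F p q')"

lemma coeff_X_mult:
  assumes "expo b i = 0" "expo b (Suc i) = 0"
  shows "coeff (X i * f) (slice_exps i b p q) =
      (- 1) ^ weight (\<lambda>j. of_bool (j < i)) b * shift1 (\<lambda>u v. coeff f (slice_exps i b u v)) p q"
    and "coeff (X (Suc i) * f) (slice_exps i b p q) =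
      (- 1) ^ (weight (\<lambda>j. of_bool (j < i)) b + p) * shift2 (\<lambda>u v. coeff f (slice_exps i b u v)) p q"
    and "coeff (f * X i) (slice_exps i b p q) =
      (- 1) ^ (q + weight (\<lambda>j. of_bool (Suc i < j)) b) * shift1 (\<lambda>u v. coeff f (slice_exps i b u v)) p q"
    and "coeff (f * X (Suc i)) (slice_exps i b p q) =
      (- 1) ^ weight (\<lambda>j. of_bool (Suc i < j)) b * shift2 (\<lambda>u v. coeff f (slice_exps i b u v)) p q"
proof -
  let ?ei = "Poly_Mapping.single i (1::nat)" and ?ej = "Poly_Mapping.single (Suc i) (1::nat)"
  have ne: "slice_exps i b 0 q \<noteq> ?ei + m" "slice_exps i b p 0 \<noteq> ?ej + m" for p q m
  proof -
    have "expo (slice_exps i b 0 q) i \<noteq> expo (?ei + m) i" "expo (slice_exps i b p 0) (Suc i) \<noteq> expo (?ej + m) (Suc i)"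
      using assms by (simp_all add: expo_slice_exps lookup_add)
    then show "slice_exps i b 0 q \<noteq> ?ei + m" "slice_exps i b p 0 \<noteq> ?ej + m" by auto
  qed
  have split: "slice_exps i b (Suc p) q = ?ei + slice_exps i b p q" "slice_exps i b p (Suc q) = ?ej + slice_exps i b p q"
    "slice_exps i b (Suc p) q = slice_exps i b p q + ?ei" "slice_exps i b p (Suc q) = slice_exps i b p q + ?ej" for p q
    by (rule poly_mapping_eqI; simp add: expo_slice_exps lookup_add lookup_single when_def)+
  have w: "weight (\<lambda>j. of_bool (j < Suc i)) b = weight (\<lambda>j. of_bool (j < i)) b"
    "weight (\<lambda>j. of_bool (i < j)) b = weight (\<lambda>j. of_bool (Suc i < j)) b"
  proof -
    have "j < Suc i \<longleftrightarrow> j < i" "i < j \<longleftrightarrow> Suc i < j" if "j \<in> Poly_Mapping.keys b" for j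
    proof -
      have "j \<noteq> i" "j \<noteq> Suc i" using that assms by (auto simp: in_keys_iff)
      then show "j < Suc i \<longleftrightarrow> j < i" "i < j \<longleftrightarrow> Suc i < j" by auto
    qed
    then show "weight (\<lambda>j. of_bool (j < Suc i)) b = weight (\<lambda>j. of_bool (j < i)) b"
      "weight (\<lambda>j. of_bool (i < j)) b = weight (\<lambda>j. of_bool (Suc i < j)) b"
      unfolding weight_def by simp_all
  qed
  have sgn: "reorder_sign ?ei (slice_exps i b p q) = (- 1) ^ weight (\<lambda>j. of_bool (j < i)) b"
    "reorder_sign ?ej (slice_exps i b p q) = (- 1) ^ (weight (\<lambda>j. of_bool (j < i)) b + p)"
    "reorder_sign (slice_exps i b p q) ?ei = (- 1) ^ (q + weight (\<lambda>j. of_bool (Suc i < j)) b)"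
    "reorder_sign (slice_exps i b p q) ?ej = (- 1) ^ weight (\<lambda>j. of_bool (Suc i < j)) b" for p q
    by (simp_all add: reorder_sign_def inversions_def slice_exps_def weight_add w add.commute)
  show "coeff (X i * f) (slice_exps i b p q) =
      (- 1) ^ weight (\<lambda>j. of_bool (j < i)) b * shift1 (\<lambda>u v. coeff f (slice_exps i b u v)) p q"
    by (cases p) (simp_all only: X_def shift1_def nat.case coeff_monom_mult_eq_0[OF ne(1)] mult_zero_right
        split(1) coeff_monom_mult(1) sgn)
  show "coeff (X (Suc i) * f) (slice_exps i b p q) =
      (- 1) ^ (weight (\<lambda>j. of_bool (j < i)) b + p) * shift2 (\<lambda>u v. coeff f (slice_exps i b u v)) p q"
    by (cases q) (simp_all only: X_def shift2_def nat.case coeff_monom_mult_eq_0[OF ne(2)] mult_zero_right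
        split(2) coeff_monom_mult(1) sgn)
  show "coeff (f * X i) (slice_exps i b p q) =
      (- 1) ^ (q + weight (\<lambda>j. of_bool (Suc i < j)) b) * shift1 (\<lambda>u v. coeff f (slice_exps i b u v)) p q"
    by (cases p) (simp_all only: X_def shift1_def nat.case coeff_monom_mult_eq_0[OF ne(1)] mult_zero_right
        split(3) coeff_monom_mult(2) sgn)
  show "coeff (f * X (Suc i)) (slice_exps i b p q) =
      (- 1) ^ weight (\<lambda>j. of_bool (Suc i < j)) b * shift2 (\<lambda>u v. coeff f (slice_exps i b u v)) p q"
    by (cases q) (simp_all only: X_def shift2_def nat.case coeff_monom_mult_eq_0[OF ne(2)] mult_zero_right
        split(4) coeff_monom_mult(2) sgn)
qed

text \<open>
  The linear form \<open>a\<close> for which \<open>f \<mapsto> a f - s(f) a\<close> is a multiple of the Demazure operator.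
\<close>

definition swap_direction :: "nat \<Rightarrow> nat \<Rightarrow> skew_poly" where
  "swap_direction i e = X i + of_int ((- 1) ^ e) * X (Suc i)"

definition swap_fixed :: "nat \<Rightarrow> nat \<Rightarrow> skew_poly set" where
  "swap_fixed i e = {f. swap_direction i e * f = swap_hom i e f * swap_direction i e}"

definition kernel_relation :: "nat \<Rightarrow> (nat \<Rightarrow> nat \<Rightarrow> int) \<Rightarrow> bool" where
  "kernel_relation e F \<longleftrightarrow> (\<forall>p q.
     shift1 F p q + (- 1) ^ (e + p) * shift2 F p q =
     (- 1) ^ (e * (p + q + 1) + p * q) * shift2 F q p + (- 1) ^ (e * (p + q) + p * (q + 1)) * shift1 F q p)"

lemma coeff_swap_hom_slice:
  assumes "expo b i = 0" "expo b (Suc i) = 0"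
  shows "coeff (swap_hom i e f) (slice_exps i b u v) =
    (- 1) ^ (weight (\<lambda>j. of_bool (j < i)) b + weight (\<lambda>j. of_bool (Suc i < j)) b + e * (u + v) + u * v)
      * coeff f (slice_exps i b v u)"
proof -
  have "weight (\<lambda>j. if j \<in> {i, Suc i} then e else 1) b =
      weight (\<lambda>j. of_bool (j < i) + of_bool (Suc i < j)) b"
    unfolding weight_def using assms
    by (intro sum.cong refl) (auto simp: not_less_eq less_Suc_eq linorder_neq_iff of_bool_def)
  then have "weight (\<lambda>j. if j \<in> {i, Suc i} then e else 1) (slice_exps i b u v) =
     weight (\<lambda>j. of_bool (j < i)) b + weight (\<lambda>j. of_bool (Suc i < j)) b + e * (u + v)"
    by (simp add: slice_exps_def weight_add weight_add_fun algebra_simps)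
  then show ?thesis
    by (simp only: coeff_swap_hom swap_slice_exps[OF assms] swap_sign_def expo_slice_exps) (simp add: assms)
qed

text \<open>
  The coefficient of the monomial with exponents \<open>p\<close>, \<open>q\<close> at \<open>i\<close>, \<open>i + 1\<close> on both sides of \<open>a f = s(f) a\<close>.
  The sign contributed by the variables to the left of \<open>x\<^sub>i\<close> is common to all four terms and cancels; the
  one from the variables to the right of \<open>x\<^bsub>i+1\<^esub>\<close> occurs twice on the right-hand side.
\<close>

lemma swap_fixed_iff_at:
  fixes f :: skew_poly
  assumes b: "expo b i = 0" "expo b (Suc i) = 0"
  defines "F \<equiv> \<lambda>u v. coeff f (slice_exps i b u v)"
  shows "coeff (swap_direction i e * f) (slice_exps i b p q) = coeff (swap_hom i e f * swap_direction i e) (slice_exps i b p q) \<longleftrightarrow>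
     shift1 F p q + (- 1) ^ (e + p) * shift2 F p q =
     (- 1) ^ (e * (p + q + 1) + p * q) * shift2 F q p + (- 1) ^ (e * (p + q) + p * (q + 1)) * shift1 F q p"
proof -
  define lo hi where "lo = weight (\<lambda>j. of_bool (j < i)) b" and "hi = weight (\<lambda>j. of_bool (Suc i < j)) b"
  have left: "coeff (swap_direction i e * f) (slice_exps i b p q) =
      (- 1) ^ lo * (shift1 F p q + (- 1) ^ (e + p) * shift2 F p q)"
    using coeff_X_mult(1,2)[OF b, of f p q]
    by (simp add: swap_direction_def algebra_simps power_add F_def lo_def
        del: of_int_power of_int_minus of_int_1) 
  have comm: "swap_hom i e f * (of_int c * X (Suc i)) = of_int c * (swap_hom i e f * X (Suc i))" for c
    by (metis mult.assoc mult_of_int_commute)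
  have s0: "(- 1) ^ (lo + hi + e * (Suc u + v + 1) + (Suc u + 1) * v) =
      ((- 1) ^ (lo + hi + e * (u + v) + u * v) :: int)" for u v
    by (rule neg_one_power_add_double[where k = "e + v"]) (simp add: algebra_simps)
  have p1: "shift1 (\<lambda>u v. coeff (swap_hom i e f) (slice_exps i b u v)) p q =
      (- 1) ^ (lo + hi + e * (p + q + 1) + (p + 1) * q) * shift2 F q p"
  proof (cases p)
    case (Suc p')
    show ?thesis unfolding Suc s0
      by (simp add: shift1_def shift2_def coeff_swap_hom_slice[OF b] F_def lo_def hi_def)
  qed (simp add: shift1_def shift2_def)
  have p2: "shift2 (\<lambda>u v. coeff (swap_hom i e f) (slice_exps i b u v)) p q =
      (- 1) ^ (lo + hi + e * (q + p + 1) + (q + 1) * p) * shift1 F q p"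
  proof (cases q)
    case (Suc q')
    show ?thesis unfolding Suc s0
      by (simp add: shift1_def shift2_def coeff_swap_hom_slice[OF b] F_def lo_def hi_def algebra_simps)
  qed (simp add: shift1_def shift2_def)
  have s1: "(- 1) ^ (q + hi) * ((- 1) ^ (lo + hi + e * (p + q + 1) + (p + 1) * q) * x) =
      (- 1) ^ lo * ((- 1) ^ (e * (p + q + 1) + p * q) * x)" for x :: int
    unfolding mult.assoc[symmetric] power_add[symmetric]
    by (rule arg_cong[where f = "\<lambda>y. y * x"], rule neg_one_power_add_double[where k = "hi + q"])
      (simp add: algebra_simps)
  have s2: "(- 1) ^ e * ((- 1) ^ hi * ((- 1) ^ (lo + hi + e * (q + p + 1) + (q + 1) * p) * x)) =
      (- 1) ^ lo * ((- 1) ^ (e * (p + q) + p * (q + 1)) * x)" for x :: int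
    unfolding mult.assoc[symmetric] power_add[symmetric]
    by (rule arg_cong[where f = "\<lambda>y. y * x"], rule neg_one_power_add_double[where k = "hi + e"])
      (simp add: algebra_simps)
  have right: "coeff (swap_hom i e f * swap_direction i e) (slice_exps i b p q) =
      (- 1) ^ lo * ((- 1) ^ (e * (p + q + 1) + p * q) * shift2 F q p
         + (- 1) ^ (e * (p + q) + p * (q + 1)) * shift1 F q p)"
    unfolding swap_direction_def distrib_left[of "swap_hom i e f"] comm coeff_simps coeff_of_int_mult coeff_X_mult(3,4)[OF b] p1 p2
      lo_def[symmetric] hi_def[symmetric] s1 s2
    by (simp only: distrib_left)
  show ?thesis unfolding left right by simp
qed

lemma swap_fixed_iff:
  "f \<in> swap_fixed i e \<longleftrightarrow>
     (\<forall>b. expo b i = 0 \<longrightarrow> expo b (Suc i) = 0 \<longrightarrow> kernel_relation e (\<lambda>u v. coeff f (slice_exps i b u v)))"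
proof -
  have "f \<in> swap_fixed i e \<longleftrightarrow>
      (\<forall>m. coeff (swap_direction i e * f) m = coeff (swap_hom i e f * swap_direction i e) m)"
    by (auto simp: swap_fixed_def intro: skew_poly_eqI)
  also have "\<dots> \<longleftrightarrow> (\<forall>b p q. expo b i = 0 \<longrightarrow> expo b (Suc i) = 0 \<longrightarrow>
      coeff (swap_direction i e * f) (slice_exps i b p q) = coeff (swap_hom i e f * swap_direction i e) (slice_exps i b p q))"
    by (metis slice_exps_exists)
  finally show ?thesis
    unfolding kernel_relation_def using swap_fixed_iff_at by simp
qed

section \<open>The recurrences and their solutions\<close>

text \<open>
  The equations at \<open>(u + 1, v)\<close> and \<open>(v, u + 1)\<close> involve the same four values, and all but
  \<open>F u v\<close> and \<open>F v u\<close> cancel in their sum or difference, depending on the parity of \<open>u\<close>.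
\<close>

lemma kernel_relation_symmetric:
  assumes "kernel_relation 1 F" "even (u + v)"
  shows "F u v = F v u"
proof -
  have *: "shift1 F p q + (- 1) ^ (1 + p) * shift2 F p q =
     (- 1) ^ (1 * (p + q + 1) + p * q) * shift2 F q p + (- 1) ^ (1 * (p + q) + p * (q + 1)) * shift1 F q p" for p q
    using assms(1) unfolding kernel_relation_def by blast
  have "shift1 F (Suc u) v = shift2 F v (Suc u)"
    using *[of "Suc u" v] *[of v "Suc u"] assms(2) by (auto simp: minus_one_power_iff split: if_splits)
  then show ?thesis by (simp add: shift1_def shift2_def)
qed

lemma kernel_relation_if_symmetric:
  assumes sym: "\<And>u v. F u v = F v u" and van: "\<And>u v. odd (u + v) \<Longrightarrow> F u v = 0"
  shows "kernel_relation e F"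
  unfolding kernel_relation_def
proof (intro allI)
  fix p q
  have sym': "shift1 F p q = shift2 F q p" for p q
    by (auto simp: shift1_def shift2_def sym split: nat.splits)
  show "shift1 F p q + (- 1) ^ (e + p) * shift2 F p q =
     (- 1) ^ (e * (p + q + 1) + p * q) * shift2 F q p + (- 1) ^ (e * (p + q) + p * (q + 1)) * shift1 F q p"
  proof (cases "even (p + q)")
    case True
    then have "shift1 F p q = 0 \<and> shift2 F p q = 0" "shift1 F q p = 0 \<and> shift2 F q p = 0"
      using van by (auto simp: shift1_def shift2_def split: nat.splits)
    then show ?thesis by simp
  next
    case False
    then show ?thesis using sym'[of p q] sym'[of q p] by (auto simp: minus_one_power_iff)
  qed
qed

text \<open>
  The two hypotheses alternate: the first moves \<open>(u, v)\<close> to \<open>(v - 1, u + 1)\<close>, the second moves this to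
  \<open>(u + 2, v - 2)\<close>. At \<open>v = 0\<close> the first one equates the value with one outside the quadrant, which is 0.
\<close>

lemma staircase_vanishing:
  assumes E: "\<And>p q. even p \<Longrightarrow> even q \<Longrightarrow> shift1 F p q = shift1 F q p"
    and O: "\<And>p q. odd p \<Longrightarrow> odd q \<Longrightarrow> shift2 F p q = shift2 F q p"
    and "odd u" "even v"
  shows "F u v = 0"
  using assms(3,4)
proof (induction v arbitrary: u rule: less_induct)
  case (less v)
  show ?case
  proof (cases v)
    case 0
    then show ?thesis using E[of "Suc u" 0] less.prems by (simp add: shift1_def)
  next
    case (Suc v')
    then obtain w where w: "v = Suc (Suc w)" using less.prems by (cases v') auto
    have "F u v = F (Suc w) (Suc u)"
      using E[of "Suc u" v] less.prems w by (simp add: shift1_def)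
    also have "\<dots> = F (Suc (Suc u)) w"
      using O[of "Suc w" "Suc (Suc u)"] less.prems w by (simp add: shift2_def)
    also have "\<dots> = 0"
      using less.IH[of w "Suc (Suc u)"] less.prems w by simp
    finally show ?thesis .
  qed
qed

text \<open>
  The mirror image, for the coefficients in which the first exponent is even.
\<close>

lemma staircase_vanishing':
  assumes E: "\<And>p q. even p \<Longrightarrow> even q \<Longrightarrow> shift2 F p q = shift2 F q p"
    and O: "\<And>p q. odd p \<Longrightarrow> odd q \<Longrightarrow> shift1 F p q = shift1 F q p"
    and "even u" "odd v"
  shows "F u v = 0"
proof -
  have flip: "shift1 (\<lambda>u v. F v u) p q = shift2 F q p" "shift2 (\<lambda>u v. F v u) p q = shift1 F q p" for p q
    by (auto simp: shift1_def shift2_def split: nat.splits)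
  show ?thesis
    by (rule staircase_vanishing[of "\<lambda>u v. F v u"]) (use assms in \<open>auto simp: flip\<close>)
qed

lemma kernel_relation_odd_pair:
  assumes "kernel_relation e F" "e \<in> {0, 1}"
  shows "even p \<Longrightarrow> even q \<Longrightarrow>
      shift1 F p q + (- 1) ^ e * shift2 F p q = shift1 F q p + (- 1) ^ e * shift2 F q p"
    and "odd p \<Longrightarrow> odd q \<Longrightarrow>
      shift1 F p q - (- 1) ^ e * shift2 F p q = (- 1) ^ (e + 1) * shift2 F q p + shift1 F q p"
proof -
  have *: "shift1 F p q + (- 1) ^ (e + p) * shift2 F p q =
     (- 1) ^ (e * (p + q + 1) + p * q) * shift2 F q p + (- 1) ^ (e * (p + q) + p * (q + 1)) * shift1 F q p"
    using assms(1) unfolding kernel_relation_def by blast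
  show "even p \<Longrightarrow> even q \<Longrightarrow>
      shift1 F p q + (- 1) ^ e * shift2 F p q = shift1 F q p + (- 1) ^ e * shift2 F q p"
    using * assms(2) by (auto simp: minus_one_power_iff)
  show "odd p \<Longrightarrow> odd q \<Longrightarrow>
      shift1 F p q - (- 1) ^ e * shift2 F p q = (- 1) ^ (e + 1) * shift2 F q p + shift1 F q p"
    using * assms(2) by (auto simp: minus_one_power_iff)
qed

text \<open>
  The equations for \<open>e = 0\<close> and \<open>e = 1\<close> differ in the sign of the \<open>shift2\<close> terms. Their sum and difference
  therefore separate the two terms and provide the hypotheses of both staircases.
\<close>

lemma kernel_relation_vanishing_both:
  assumes "kernel_relation 0 F" "kernel_relation 1 F" "odd (u + v)"
  shows "F u v = 0"
proof -
  have "shift1 F p q = shift1 F q p" "shift2 F p q = shift2 F q p" if "even p \<and> even q \<or> odd p \<and> odd q" for p q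
    using that kernel_relation_odd_pair[OF assms(1), of p q] kernel_relation_odd_pair[OF assms(2), of p q] by auto
  then show ?thesis
    using assms(3) staircase_vanishing[of F u v] staircase_vanishing'[of F u v] by auto
qed

text \<open>
  With a single equation, knowing that one of the two parity classes vanishes removes the \<open>shift2\<close> terms
  from the equations of one parity and the \<open>shift1\<close> terms from the others, which is what the staircase
  for the other class needs.
\<close>

lemma kernel_relation_vanishing_half:
  assumes "kernel_relation 1 F" "odd (u + v)"
    and "(\<forall>u v. even u \<longrightarrow> odd v \<longrightarrow> F u v = 0) \<or> (\<forall>u v. odd u \<longrightarrow> even v \<longrightarrow> F u v = 0)"
  shows "F u v = 0"
  using assms(3)
proof
  assume z: "\<forall>u v. even u \<longrightarrow> odd v \<longrightarrow> F u v = 0"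
  then have "even p \<Longrightarrow> even q \<Longrightarrow> shift2 F p q = 0" "odd p \<Longrightarrow> odd q \<Longrightarrow> shift1 F p q = 0" for p q
    by (auto simp: shift1_def shift2_def split: nat.splits)
  then have "odd u \<Longrightarrow> even v \<Longrightarrow> F u v = 0"
    using kernel_relation_odd_pair[OF assms(1)] by (intro staircase_vanishing) fastforce+
  then show ?thesis using z assms(2) by auto
next
  assume z: "\<forall>u v. odd u \<longrightarrow> even v \<longrightarrow> F u v = 0"
  then have "even p \<Longrightarrow> even q \<Longrightarrow> shift1 F p q = 0" "odd p \<Longrightarrow> odd q \<Longrightarrow> shift2 F p q = 0" for p q
    by (auto simp: shift1_def shift2_def split: nat.splits)
  then have "even u \<Longrightarrow> odd v \<Longrightarrow> F u v = 0"
    using kernel_relation_odd_pair[OF assms(1)] by (intro staircase_vanishing') fastforce+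
  then show ?thesis using z assms(2) by auto
qed

definition typeD_symmetric :: "nat \<Rightarrow> skew_poly \<Rightarrow> bool" where
  "typeD_symmetric n f \<longleftrightarrow>
     (\<forall>i\<in>{1..<n}. (\<forall>m\<in>support f. even (expo m i + expo m (Suc i))) \<and>
        (\<forall>m. coeff f (swap i m) = coeff f m))"

text \<open>
  Equality of the parities of neighbouring exponents is proved by descending induction on \<open>i\<close>. It starts
  at \<open>i = n - 1\<close>, the only index with two equations. In the step, the exponents of \<open>x\<^bsub>i+1\<^esub>\<close> and
  \<open>x\<^bsub>i+2\<^esub>\<close> have equal parity; since the latter is fixed, one of the two parity classes for the
  exponents of \<open>x\<^sub>i\<close> and \<open>x\<^bsub>i+1\<^esub>\<close> is excluded.
\<close>

lemma typeD_symmetric_iff_swap_fixed: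
  assumes "n \<ge> 2"
  shows "(\<forall>i\<in>{1..<n}. f \<in> swap_fixed i 1) \<and> f \<in> swap_fixed (n - 1) 0 \<longleftrightarrow> typeD_symmetric n f"
proof
  assume fixed: "(\<forall>i\<in>{1..<n}. f \<in> swap_fixed i 1) \<and> f \<in> swap_fixed (n - 1) 0"
  have rel: "kernel_relation 1 (\<lambda>u v. coeff f (slice_exps i b u v))"
    if "i \<in> {1..<n}" "expo b i = 0" "expo b (Suc i) = 0" for i b
    using fixed that by (simp add: swap_fixed_iff)
  have par: "\<forall>m. odd (expo m i + expo m (Suc i)) \<longrightarrow> coeff f m = 0" if "i \<le> n - 1" "1 \<le> i" for i
    using that
  proof (induction i rule: inc_induct)
    case base
    show ?case
    proof (intro allI impI)
      fix m assume m: "odd (expo m (n - 1) + expo m (Suc (n - 1)))"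
      obtain b where b: "expo b (n - 1) = 0" "expo b (Suc (n - 1)) = 0"
        and mb: "m = slice_exps (n - 1) b (expo m (n - 1)) (expo m (Suc (n - 1)))" by (rule slice_exps_exists)
      have "kernel_relation 0 (\<lambda>u v. coeff f (slice_exps (n - 1) b u v))"
        using fixed b unfolding swap_fixed_iff by blast
      from kernel_relation_vanishing_both[OF this rel[OF _ b] m] show "coeff f m = 0"
        using base assms mb by simp
    qed
  next
    case (step i)
    show ?case
    proof (intro allI impI)
      fix m assume m: "odd (expo m i + expo m (Suc i))"
      obtain b where b: "expo b i = 0" "expo b (Suc i) = 0"
        and mb: "m = slice_exps i b (expo m i) (expo m (Suc i))" by (rule slice_exps_exists)
      let ?F = "\<lambda>u v. coeff f (slice_exps i b u v)"
      have "?F u v = 0" if "odd (v + expo b (Suc (Suc i)))" for u v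
        using step.IH that b by (simp add: expo_slice_exps)
      then have "(\<forall>u v. even u \<longrightarrow> odd v \<longrightarrow> ?F u v = 0) \<or> (\<forall>u v. odd u \<longrightarrow> even v \<longrightarrow> ?F u v = 0)"
        by (cases "even (expo b (Suc (Suc i)))") auto
      from kernel_relation_vanishing_half[OF rel[OF _ b] m this] show "coeff f m = 0"
        using step mb by simp
    qed
  qed
  show "typeD_symmetric n f"
    unfolding typeD_symmetric_def
  proof (intro ballI conjI allI)
    fix i m assume "i \<in> {1..<n}" "m \<in> support f"
    then have "coeff f m \<noteq> 0" "i \<le> n - 1" "1 \<le> i" by (auto simp: in_keys_iff)
    then show "even (expo m i + expo m (Suc i))" using par by blast
  next
    fix i m assume i: "i \<in> {1..<n}"
    obtain b where b: "expo b i = 0" "expo b (Suc i) = 0"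
      and mb: "m = slice_exps i b (expo m i) (expo m (Suc i))" by (rule slice_exps_exists)
    have "coeff f (slice_exps i b (expo m (Suc i)) (expo m i)) = coeff f (slice_exps i b (expo m i) (expo m (Suc i)))"
    proof (cases "even (expo m i + expo m (Suc i))")
      case True
      then show ?thesis using kernel_relation_symmetric[OF rel[OF i b]] by (simp add: add.commute)
    next
      case False
      have "i \<le> n - 1" "1 \<le> i" using i by auto
      from par[OF this] False b show ?thesis by (simp add: expo_slice_exps)
    qed
    then show "coeff f (swap i m) = coeff f m"
      using swap_slice_exps[OF b] mb by metis
  qed
next
  assume inv: "typeD_symmetric n f"
  have "f \<in> swap_fixed i e" if i: "i \<in> {1..<n}" for i e
    unfolding swap_fixed_iff
  proof (intro allI impI kernel_relation_if_symmetric)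
    fix b assume b: "expo b i = 0" "expo b (Suc i) = 0"
    show "coeff f (slice_exps i b u v) = coeff f (slice_exps i b v u)" for u v
    proof -
      have "coeff f (swap i (slice_exps i b v u)) = coeff f (slice_exps i b v u)"
        using inv i unfolding typeD_symmetric_def by blast
      then show ?thesis by (simp add: swap_slice_exps[OF b])
    qed
    show "coeff f (slice_exps i b u v) = 0" if "odd (u + v)" for u v
    proof (rule ccontr)
      assume "coeff f (slice_exps i b u v) \<noteq> 0"
      then have "slice_exps i b u v \<in> support f" by (simp add: in_keys_iff)
      then have "even (expo (slice_exps i b u v) i + expo (slice_exps i b u v) (Suc i))"
        using inv i unfolding typeD_symmetric_def by blast
      then show False using that b by (simp add: expo_slice_exps)
    qed
  qed
  then show "(\<forall>i\<in>{1..<n}. f \<in> swap_fixed i 1) \<and> f \<in> swap_fixed (n - 1) 0"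
    using assms by simp
qed

section \<open>Elementary symmetric functions of type D\<close>

definition skew_polys :: "nat \<Rightarrow> skew_poly set" where
  "skew_polys n = {f. \<forall>m\<in>support f. Poly_Mapping.keys m \<subseteq> {1..n}}"

lemma skew_polys_zero: "0 \<in> skew_polys n"
  by (simp add: skew_polys_def zero_skew_poly_def)

lemma skew_polys_monom: "monom a \<in> skew_polys n \<longleftrightarrow> Poly_Mapping.keys a \<subseteq> {1..n}"
  by (simp add: skew_polys_def monom_def)

lemma skew_polys_one: "1 \<in> skew_polys n"
  using skew_polys_monom[of 0 n] by (simp add: monom_zero)

lemma skew_polys_X: "i \<in> {1..n} \<Longrightarrow> X i \<in> skew_polys n"
  by (simp add: X_def skew_polys_monom)

lemma skew_polys_add: "f \<in> skew_polys n \<Longrightarrow> g \<in> skew_polys n \<Longrightarrow> f + g \<in> skew_polys n"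
  using Poly_Mapping.keys_add[of "coeffs f" "coeffs g"]
  by (auto simp: skew_polys_def plus_skew_poly_def)

lemma skew_polys_diff: "f \<in> skew_polys n \<Longrightarrow> g \<in> skew_polys n \<Longrightarrow> f - g \<in> skew_polys n"
  using keys_diff[of "coeffs f" "coeffs g"]
  by (auto simp: skew_polys_def minus_skew_poly_def)

lemma skew_polys_uminus: "f \<in> skew_polys n \<Longrightarrow> - f \<in> skew_polys n"
  using skew_polys_diff[OF skew_polys_zero] by fastforce

lemma skew_polys_mult: "f \<in> skew_polys n \<Longrightarrow> g \<in> skew_polys n \<Longrightarrow> f * g \<in> skew_polys n"
  unfolding skew_polys_def using support_mult[of _ f g] Poly_Mapping.keys_add by fastforce

lemma skew_polys_of_int_mult: "f \<in> skew_polys n \<Longrightarrow> of_int c * f \<in> skew_polys n"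
  by (auto simp: skew_polys_def coeffs_of_int_mult)

lemma skew_polys_sum: "(\<And>i. i \<in> I \<Longrightarrow> f i \<in> skew_polys n) \<Longrightarrow> sum f I \<in> skew_polys n"
  by (induction I rule: infinite_finite_induct) (auto simp: skew_polys_zero skew_polys_add)

lemma skew_polys_prod_list: "(\<And>f. f \<in> set fs \<Longrightarrow> f \<in> skew_polys n) \<Longrightarrow> prod_list fs \<in> skew_polys n"
  by (induction fs) (auto simp: skew_polys_one skew_polys_mult)

definition const_exps :: "nat \<Rightarrow> nat set \<Rightarrow> exps" where
  "const_exps c I = (\<Sum>i\<in>I. Poly_Mapping.single i c)"

lemma expo_const_exps: "finite I \<Longrightarrow> expo (const_exps c I) k = (if k \<in> I then c else 0)"
  by (simp add: const_exps_def lookup_sum lookup_single when_def)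

lemma keys_const_exps: "finite I \<Longrightarrow> c \<noteq> 0 \<Longrightarrow> Poly_Mapping.keys (const_exps c I) = I"
  by (auto simp: in_keys_iff expo_const_exps split: if_splits)

definition elementary :: "nat \<Rightarrow> nat \<Rightarrow> skew_poly" where
  "elementary n k =
     (if k < n then \<Sum>I\<in>{I. I \<subseteq> {1..n} \<and> card I = k}. monom (const_exps 2 I)
      else monom (const_exps 1 {1..n}))"

lemma coeff_sum: "coeff (sum f I) m = (\<Sum>i\<in>I. coeff (f i) m)"
  by (induction I rule: infinite_finite_induct) auto

text \<open>
  The index set of a square monomial is its support, so the sum defining the elementary function has at
  most one summand that contributes.
\<close>

lemma coeff_elementary:
  assumes "k < n"
  shows "coeff (elementary n k) m =
     of_bool (m = const_exps 2 (Poly_Mapping.keys m) \<and> Poly_Mapping.keys m \<subseteq> {1..n} \<and> card (Poly_Mapping.keys m) = k)"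
proof -
  let ?S = "{I. I \<subseteq> {1..n} \<and> card I = k}"
  have fin: "finite ?S" by (rule finite_subset[of _ "Pow {1..n}"]) auto
  define B where "B \<longleftrightarrow> m = const_exps 2 (Poly_Mapping.keys m)"
  have term_eq: "coeff (monom (const_exps 2 I)) m = (if I = Poly_Mapping.keys m then of_bool B else 0)"
    if "I \<in> ?S" for I
  proof -
    have "finite I" using that finite_subset by blast
    then have "Poly_Mapping.keys (const_exps 2 I) = I" by (simp add: keys_const_exps)
    then have "m = const_exps 2 I \<longleftrightarrow> I = Poly_Mapping.keys m \<and> B" unfolding B_def by metis
    then show ?thesis by (simp add: coeff_monom)
  qed
  have "coeff (elementary n k) m = (\<Sum>I\<in>?S. coeff (monom (const_exps 2 I)) m)"
    using assms by (simp add: elementary_def coeff_sum)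
  also have "\<dots> = (\<Sum>I\<in>?S. if I = Poly_Mapping.keys m then of_bool B else 0)"
    by (rule sum.cong[OF refl term_eq])
  also have "\<dots> = (if Poly_Mapping.keys m \<in> ?S then of_bool B else 0)"
    using fin by (rule sum.delta)
  also have "\<dots> = of_bool (B \<and> Poly_Mapping.keys m \<subseteq> {1..n} \<and> card (Poly_Mapping.keys m) = k)"
    by (simp add: of_bool_def)
  finally show ?thesis unfolding B_def .
qed

lemma elementary_in_skew_polys: "elementary n k \<in> skew_polys n"
proof (cases "k < n")
  case True
  have "monom (const_exps 2 I) \<in> skew_polys n" if "I \<subseteq> {1..n}" for I
    using that finite_subset[OF that] by (simp add: skew_polys_monom keys_const_exps)
  then show ?thesis using True by (auto simp: elementary_def intro: skew_polys_sum)
qed (simp add: elementary_def skew_polys_monom keys_const_exps)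

lemma elementary_symmetric: "typeD_symmetric n (elementary n k)"
proof (cases "k < n")
  case True
  have "coeff (elementary n k) (swap i m) = coeff (elementary n k) m" if i: "i \<in> {1..<n}" for i m
  proof -
    let ?t = "transpose i (Suc i)" and ?K = "Poly_Mapping.keys m"
    have image: "x \<in> ?t ` ?K \<longleftrightarrow> ?t x \<in> ?K" for x
      using image_eqI[of x ?t "?t x" ?K] by auto
    have keys: "Poly_Mapping.keys (swap i m) = ?t ` ?K"
      by (rule Set.set_eqI) (simp add: image, simp add: in_keys_iff)
    have "swap i (const_exps 2 ?K) = const_exps 2 (?t ` ?K)"
      by (rule poly_mapping_eqI) (simp add: expo_const_exps image)
    then have "swap i m = const_exps 2 (?t ` ?K) \<longleftrightarrow> m = const_exps 2 ?K"
      by (metis swap_swap)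
    moreover have "?t ` ?K \<subseteq> {1..n} \<longleftrightarrow> ?K \<subseteq> {1..n}"
    proof -
      have "?t ` {1..n} = {1..n}" using i by (intro transpose_image_eq) auto
      then show ?thesis by (metis inj_image_subset_iff inj_transpose)
    qed
    moreover have "card (?t ` ?K) = card ?K" by (intro card_image) simp
    ultimately show ?thesis unfolding coeff_elementary[OF True] keys by simp
  qed
  moreover have "even (expo m i)" if "m \<in> support (elementary n k)" for m i
  proof -
    have "m = const_exps 2 (Poly_Mapping.keys m)"
      using that by (simp add: in_keys_iff coeff_elementary[OF True] split: if_splits)
    then have "expo m i = (if i \<in> Poly_Mapping.keys m then 2 else 0)"
      by (metis expo_const_exps finite_keys)
    then show ?thesis by simp
  qed
  ultimately show ?thesis unfolding typeD_symmetric_def by simp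
next
  case False
  have "swap i m = const_exps 1 {1..n} \<longleftrightarrow> m = const_exps 1 {1..n}" if "i \<in> {1..<n}" for i m
  proof -
    have "swap i (const_exps 1 {1..n}) = const_exps 1 {1..n}"
      by (rule poly_mapping_eqI) (use that in \<open>auto simp: expo_const_exps transpose_def\<close>)
    then show ?thesis by (metis swap_swap)
  qed
  then show ?thesis
    using False by (auto simp: typeD_symmetric_def elementary_def coeff_monom in_keys_iff expo_const_exps)
qed

text \<open>
  As the kernel of a twisted derivation, this is a subring: \<open>a f g = s(f) a g = s(f) s(g) a\<close>.
\<close>

lemma swap_fixed_closed:
  "1 \<in> swap_fixed i e" "f \<in> swap_fixed i e \<Longrightarrow> g \<in> swap_fixed i e \<Longrightarrow> f - g \<in> swap_fixed i e"
  "f \<in> swap_fixed i e \<Longrightarrow> g \<in> swap_fixed i e \<Longrightarrow> f * g \<in> swap_fixed i e"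
proof -
  show "1 \<in> swap_fixed i e" by (simp add: swap_fixed_def)
  show "f - g \<in> swap_fixed i e" if "f \<in> swap_fixed i e" "g \<in> swap_fixed i e"
    using that by (simp add: swap_fixed_def swap_hom_diff algebra_simps)
  show "f * g \<in> swap_fixed i e" if "f \<in> swap_fixed i e" "g \<in> swap_fixed i e"
  proof -
    have "swap_direction i e * (f * g) = swap_hom i e f * (swap_direction i e * g)"
      using that(1) by (simp add: swap_fixed_def mult.assoc[symmetric])
    also have "\<dots> = swap_hom i e (f * g) * swap_direction i e"
      using that(2) by (simp add: swap_fixed_def swap_hom_mult mult.assoc)
    finally show ?thesis by (simp add: swap_fixed_def)
  qed
qed

definition typeD_polys :: "nat \<Rightarrow> skew_poly set" where
  "typeD_polys n = {f \<in> skew_polys n. typeD_symmetric n f}"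

lemma typeD_polys_closed:
  assumes "n \<ge> 2"
  shows "1 \<in> typeD_polys n"
    and "f \<in> typeD_polys n \<Longrightarrow> g \<in> typeD_polys n \<Longrightarrow> f - g \<in> typeD_polys n"
    and "f \<in> typeD_polys n \<Longrightarrow> g \<in> typeD_polys n \<Longrightarrow> f * g \<in> typeD_polys n"
  unfolding typeD_polys_def mem_Collect_eq typeD_symmetric_iff_swap_fixed[OF assms, symmetric]
  by (auto intro: swap_fixed_closed skew_polys_one skew_polys_diff skew_polys_mult)

lemma typeD_polys_of_int_mult: "f \<in> typeD_polys n \<Longrightarrow> of_int c * f \<in> typeD_polys n"
  by (auto simp: typeD_polys_def skew_polys_of_int_mult typeD_symmetric_def in_keys_iff)

lemma typeD_polys_power: "n \<ge> 2 \<Longrightarrow> f \<in> typeD_polys n \<Longrightarrow> f ^ k \<in> typeD_polys n"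
  by (induction k) (auto intro: typeD_polys_closed)

lemma typeD_polys_prod_list:
  "n \<ge> 2 \<Longrightarrow> (\<And>f. f \<in> set fs \<Longrightarrow> f \<in> typeD_polys n) \<Longrightarrow> prod_list fs \<in> typeD_polys n"
  by (induction fs) (auto intro: typeD_polys_closed)

lemma elementary_in_typeD_polys: "elementary n k \<in> typeD_polys n"
  by (simp add: typeD_polys_def elementary_in_skew_polys elementary_symmetric)

text \<open>
  Every letter occurs an even number of times, so the signs in both directions are trivial.
\<close>

lemma monom_even_commute:
  assumes "\<And>i. even (expo a i)"
  shows "monom a * f = f * monom a"
proof -
  have "even (inversions a b)" "even (inversions b a)" for b
  proof -
    have ev: "even (weight w a)" for w
      using assms by (auto simp: weight_def intro!: dvd_sum)
    show "even (inversions a b)"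
      using assms by (auto simp: inversions_def weight_def[of _ a] intro!: dvd_sum)
    show "even (inversions b a)"
      using ev by (auto simp: inversions_def weight_def[of _ b] intro!: dvd_sum)
  qed
  then have "reorder_sign a b = 1" "reorder_sign b a = 1" for b
    by (simp_all add: reorder_sign_def)
  note signs = this
  show ?thesis
    using subset_UNIV
    by (induction f rule: skew_poly_induct) (simp_all add: monom_mult signs add.commute algebra_simps)
qed

lemma elementary_central: "k < n \<Longrightarrow> elementary n k * f = f * elementary n k"
proof -
  assume "k < n"
  have "monom (const_exps 2 I) * f = f * monom (const_exps 2 I)" if "I \<subseteq> {1..n}" for I
    using finite_subset[OF that] by (intro monom_even_commute) (simp add: expo_const_exps)
  then show ?thesis
    using \<open>k < n\<close> by (auto simp: elementary_def sum_distrib_left sum_distrib_right intro!: sum.cong)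
qed

lemma elementary_commute: "elementary n j * elementary n k = elementary n k * elementary n j"
proof (cases "j < n \<or> k < n")
  case True
  then show ?thesis using elementary_central[of j n] elementary_central[of k n] by metis
next
  case False
  then show ?thesis by (simp add: elementary_def)
qed

section \<open>Leading monomials\<close>

text \<open>
  The leading coefficient is only required to be a unit of the integers, because products of monic
  elements acquire signs.
\<close>

definition monic_at :: "skew_poly \<Rightarrow> exps \<Rightarrow> bool" where
  "monic_at f m \<longleftrightarrow> \<bar>coeff f m\<bar> = 1 \<and> (\<forall>a\<in>support f. a \<le> m)"

lemma monic_at_one: "monic_at 1 0"
  by (simp add: monic_at_def one_skew_poly_def)

lemma monic_at_mult:
  assumes "monic_at f m" "monic_at g k"
  shows "monic_at (f * g) (m + k)"
  unfolding monic_at_def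
proof (intro conjI ballI)
  show "\<bar>coeff (f * g) (m + k)\<bar> = 1"
    using assms by (simp add: monic_at_def coeff_mult_leading abs_mult reorder_sign_abs)
  fix a assume "a \<in> support (f * g)"
  then show "a \<le> m + k"
    using support_mult[of a f g] assms by (auto simp: monic_at_def intro: add_mono)
qed

lemma monic_at_power: "monic_at f m \<Longrightarrow> monic_at (f ^ j) (\<Sum>l<j. m)"
  by (induction j) (auto simp: monic_at_one add.commute[of _ m] intro: monic_at_mult simp del: sum_constant)

lemma monic_at_prod_list:
  "(\<And>k. k \<in> set ks \<Longrightarrow> monic_at (f k) (m k)) \<Longrightarrow>
     monic_at (prod_list (map f ks)) (sum_list (map m ks))"
  by (induction ks) (auto simp: monic_at_one intro: monic_at_mult)

lemma exps_less_iff: "a < b \<longleftrightarrow> (\<exists>k. expo a k < expo b k \<and> (\<forall>k'<k. expo a k' = expo b k'))"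
  for a b :: exps
  by (simp add: less_poly_mapping.rep_eq less_fun_def)

definition elementary_top :: "nat \<Rightarrow> nat \<Rightarrow> exps" where
  "elementary_top n k = (if k < n then const_exps 2 {1..k} else const_exps 1 {1..n})"

text \<open>
  If a set \<open>I\<close> of size \<open>k\<close> differs from \<open>{1..k}\<close>, it misses some \<open>j \<le> k\<close>; below the least such \<open>j\<close> both sets
  agree, so the monomial of \<open>I\<close> is smaller.
\<close>

lemma monic_at_elementary: "monic_at (elementary n k) (elementary_top n k)"
proof (cases "k < n")
  case False
  then show ?thesis by (simp add: monic_at_def elementary_def elementary_top_def monom_def)
next
  case True
  have "coeff (elementary n k) (const_exps 2 {1..k}) = 1"
    using True by (simp add: coeff_elementary keys_const_exps)
  moreover have "m \<le> const_exps 2 {1..k}" if "m \<in> support (elementary n k)" for m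
  proof -
    let ?I = "Poly_Mapping.keys m"
    have m: "m = const_exps 2 ?I" and I: "?I \<subseteq> {1..n}" "card ?I = k"
      using that unfolding in_keys_iff coeff_elementary[OF True] by (auto split: if_splits)
    show ?thesis
    proof (cases "{1..k} - ?I = {}")
      case True
      then have "?I = {1..k}" using card_subset_eq[of ?I "{1..k}"] I(2) by simp
      then show ?thesis using m by simp
    next
      case False
      define j where "j = Min ({1..k} - ?I)"
      have j: "j \<in> {1..k} - ?I" unfolding j_def by (rule Min_in) (use False in auto)
      have "j' \<in> ?I \<longleftrightarrow> j' \<in> {1..k}" if "j' < j" for j'
      proof -
        have "j' \<notin> {1..k} - ?I"
        proof
          assume "j' \<in> {1..k} - ?I"
          then have "j \<le> j'" unfolding j_def by (intro Min_le) auto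
          then show False using that by simp
        qed
        moreover have "j' \<notin> ?I" if "j' = 0" using I(1) that by auto
        ultimately show ?thesis using \<open>j' < j\<close> j by (cases "j' = 0") auto
      qed
      moreover have "expo m l = (if l \<in> ?I then 2 else 0)" for l
        using m by (metis expo_const_exps finite_keys)
      ultimately have "m < const_exps 2 {1..k}"
        using j unfolding exps_less_iff by (intro exI[of _ j]) (auto simp: expo_const_exps)
      then show ?thesis by simp
    qed
  qed
  ultimately show ?thesis using True by (simp add: monic_at_def elementary_top_def)
qed

definition elementary_monom :: "nat \<Rightarrow> exps \<Rightarrow> skew_poly" where
  "elementary_monom n \<mu> = prod_list (map (\<lambda>k. elementary n k ^ expo \<mu> k) [1..<Suc n])"

definition leading_exps :: "nat \<Rightarrow> exps \<Rightarrow> exps" where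
  "leading_exps n \<mu> = (\<Sum>k\<in>{1..n}. \<Sum>l<expo \<mu> k. elementary_top n k)"

lemma monic_at_elementary_monom: "monic_at (elementary_monom n \<mu>) (leading_exps n \<mu>)"
proof -
  have "leading_exps n \<mu> = sum_list (map (\<lambda>k. \<Sum>l<expo \<mu> k. elementary_top n k) [1..<Suc n])"
    unfolding leading_exps_def by (subst interv_sum_list_conv_sum_set_nat) (simp only: set_upt atLeastLessThanSuc_atLeastAtMost)
  then show ?thesis
    unfolding elementary_monom_def by (simp only:) (intro monic_at_prod_list monic_at_power monic_at_elementary)
qed

lemma elementary_monom_in_typeD_polys: "n \<ge> 2 \<Longrightarrow> elementary_monom n \<mu> \<in> typeD_polys n"
  unfolding elementary_monom_def
  by (rule typeD_polys_prod_list) (auto intro: typeD_polys_power elementary_in_typeD_polys)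

lemma expo_leading_exps: "expo (leading_exps n \<mu>) i = (\<Sum>k\<in>{1..n}. expo \<mu> k * expo (elementary_top n k) i)"
  by (simp add: leading_exps_def lookup_sum del: sum_constant) simp

text \<open>
  Only the \<open>i\<close>-th generator contains \<open>x\<^sub>i\<close> to a higher power than \<open>x\<^bsub>i+1\<^esub>\<close> in its leading monomial. Together
  with \<open>leading_exps_last\<close> this recovers the exponents \<open>\<mu>\<close> from the leading exponents.
\<close>

lemma leading_exps_step:
  assumes "1 \<le> i" "i < n"
  shows "expo (leading_exps n \<mu>) i = 2 * expo \<mu> i + expo (leading_exps n \<mu>) (Suc i)"
proof -
  have "expo (elementary_top n k) i = (if k = i then 2 else 0) + expo (elementary_top n k) (Suc i)" for k
    using assms by (auto simp: elementary_top_def expo_const_exps)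
  then have "expo (leading_exps n \<mu>) i =
      (\<Sum>k\<in>{1..n}. (if k = i then 2 * expo \<mu> i else 0) + expo \<mu> k * expo (elementary_top n k) (Suc i))"
    unfolding expo_leading_exps by (intro sum.cong refl) (simp add: algebra_simps)
  also have "\<dots> = 2 * expo \<mu> i + expo (leading_exps n \<mu>) (Suc i)"
    using assms by (simp add: sum.distrib expo_leading_exps)
  finally show ?thesis .
qed

lemma leading_exps_last:
  assumes "1 \<le> n"
  shows "expo (leading_exps n \<mu>) n = expo \<mu> n"
proof -
  have "expo (leading_exps n \<mu>) n = (\<Sum>k\<in>{1..n}. if k = n then expo \<mu> n else 0)"
    unfolding expo_leading_exps using assms
    by (intro sum.cong refl) (auto simp: elementary_top_def expo_const_exps)
  then show ?thesis using assms by simp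
qed

lemma leading_exps_inj:
  assumes "1 \<le> n" "leading_exps n \<mu> = leading_exps n \<nu>"
    and "Poly_Mapping.keys \<mu> \<subseteq> {1..n}" "Poly_Mapping.keys \<nu> \<subseteq> {1..n}"
  shows "\<mu> = \<nu>"
proof (rule poly_mapping_eqI)
  fix k
  show "expo \<mu> k = expo \<nu> k"
  proof (cases "k \<in> {1..n}")
    case False
    then have "k \<notin> Poly_Mapping.keys \<mu>" "k \<notin> Poly_Mapping.keys \<nu>" using assms(3,4) by auto
    then show ?thesis by (simp add: in_keys_iff)
  next
    case True
    then show ?thesis
      using leading_exps_last[OF assms(1), of \<mu>] leading_exps_last[OF assms(1), of \<nu>]
        leading_exps_step[of k n \<mu>] leading_exps_step[of k n \<nu>] assms(2)
      by (cases "k = n") auto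
  qed
qed

text \<open>
  The exponents of the generators are the last exponent of \<open>m\<close> and the halved differences of its
  neighbouring exponents; parity and monotonicity make these natural numbers.
\<close>

lemma leading_exps_surj:
  assumes n: "1 \<le> n" and m: "Poly_Mapping.keys m \<subseteq> {1..n}"
    and par: "\<And>i. i \<in> {1..<n} \<Longrightarrow> even (expo m i + expo m (Suc i))"
    and dec: "\<And>i. i \<in> {1..<n} \<Longrightarrow> expo m (Suc i) \<le> expo m i"
  shows "\<exists>\<mu>. Poly_Mapping.keys \<mu> \<subseteq> {1..n} \<and> leading_exps n \<mu> = m"
proof -
  define c where "c k = (if k = n then expo m n else (expo m k - expo m (Suc k)) div 2)" for k
  define \<mu> where "\<mu> = (\<Sum>k\<in>{1..n}. Poly_Mapping.single k (c k))"
  have \<mu>: "expo \<mu> k = (if k \<in> {1..n} then c k else 0)" for k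
    by (simp add: \<mu>_def lookup_sum lookup_single when_def)
  have top: "expo (leading_exps n \<mu>) i = expo m i" if "i \<le> n" "1 \<le> i" for i
    using that
  proof (induction i rule: inc_induct)
    case base
    then show ?case by (simp add: leading_exps_last[OF n] \<mu> c_def)
  next
    case (step i)
    then have "expo (leading_exps n \<mu>) i = 2 * c i + expo m (Suc i)"
      by (simp add: leading_exps_step \<mu>)
    also have "2 * c i = expo m i - expo m (Suc i)"
      using par[of i] dec[of i] step by (auto simp: c_def)
    finally show ?case using dec[of i] step by simp
  qed
  have "leading_exps n \<mu> = m"
  proof (rule poly_mapping_eqI)
    fix k
    show "expo (leading_exps n \<mu>) k = expo m k"
    proof (cases "k \<in> {1..n}")
      case True
      then show ?thesis using top by simp
    next
      case False
      then have "expo m k = 0" using m by (metis in_keys_iff subsetD)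
      moreover have "expo (elementary_top n l) k = 0" if "l \<in> {1..n}" for l
        using False that by (auto simp: elementary_top_def expo_const_exps)
      ultimately show ?thesis by (simp add: expo_leading_exps)
    qed
  qed
  moreover have "Poly_Mapping.keys \<mu> \<subseteq> {1..n}" by (auto simp: in_keys_iff \<mu> split: if_splits)
  ultimately show ?thesis by blast
qed

lemma prod_list_commute:
  fixes x :: "'k \<Rightarrow> 'r::monoid_mult"
  assumes "\<And>k. k \<in> set ks \<Longrightarrow> y * x k = x k * y"
  shows "y * prod_list (map x ks) = prod_list (map x ks) * y"
  using assms
proof (induction ks)
  case (Cons k ks)
  have "y * (x k * prod_list (map x ks)) = x k * (y * prod_list (map x ks))"
    using Cons.prems by (simp add: mult.assoc[symmetric])
  then show ?case using Cons by (simp add: mult.assoc)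
qed simp

text \<open>
  Needed because the ambient ring is not commutative, although the generators commute with each other.
\<close>

lemma prod_list_power_add:
  fixes x :: "'k \<Rightarrow> 'r::monoid_mult"
  assumes "\<And>j k. x j * x k = x k * x j"
  shows "prod_list (map (\<lambda>k. x k ^ (a k + b k)) ks) =
    prod_list (map (\<lambda>k. x k ^ a k) ks) * prod_list (map (\<lambda>k. x k ^ b k) ks)"
proof (induction ks)
  case (Cons k ks)
  have "x k ^ b k * prod_list (map (\<lambda>k. x k ^ a k) ks) = prod_list (map (\<lambda>k. x k ^ a k) ks) * x k ^ b k"
    by (intro prod_list_commute) (metis assms power_commuting_commutes)
  then show ?case using Cons by (simp add: power_add mult.assoc) (simp add: mult.assoc[symmetric])
qed simp

lemma elementary_monom_add: "elementary_monom n (\<mu> + \<nu>) = elementary_monom n \<mu> * elementary_monom n \<nu>"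
  unfolding elementary_monom_def lookup_add by (rule prod_list_power_add) (rule elementary_commute)

lemma prod_list_single:
  "distinct ks \<Longrightarrow> prod_list (map (\<lambda>j. if j = k then y else 1) ks) = (if k \<in> set ks then y else (1::'r::monoid_mult))"
  by (induction ks) auto

lemma elementary_monom_single:
  assumes "k \<in> {1..n}"
  shows "elementary_monom n (Poly_Mapping.single k 1) = elementary n k"
proof -
  have "elementary_monom n (Poly_Mapping.single k 1) =
      prod_list (map (\<lambda>j. if j = k then elementary n k else 1) [1..<Suc n])"
    unfolding elementary_monom_def
    by (intro arg_cong[where f = prod_list] map_cong refl) (auto simp: lookup_single when_def)
  also have "\<dots> = elementary n k"
    by (subst prod_list_single) (use assms in auto)
  finally show ?thesis .
qed

definition eval_elementary :: "nat \<Rightarrow> (exps \<Rightarrow>\<^sub>0 int) \<Rightarrow> skew_poly" where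
  "eval_elementary n p = Skew (frag_extend (\<lambda>\<mu>. coeffs (elementary_monom n \<mu>)) p)"

lemma eval_elementary_of [simp]: "eval_elementary n (frag_of \<mu>) = elementary_monom n \<mu>"
  by (simp add: eval_elementary_def)

lemma eval_elementary_add: "eval_elementary n (p + q) = eval_elementary n p + eval_elementary n q"
  by (simp add: eval_elementary_def frag_extend_add plus_skew_poly_def)

lemma eval_elementary_diff: "eval_elementary n (p - q) = eval_elementary n p - eval_elementary n q"
  by (simp add: eval_elementary_def frag_extend_diff minus_skew_poly_def)

lemma eval_elementary_zero [simp]: "eval_elementary n 0 = 0"
  using eval_elementary_diff[of n 0 0] by simp

lemma eval_elementary_cmul: "eval_elementary n (frag_cmul c p) = of_int c * eval_elementary n p"
  by (rule skew_poly.expand) (simp add: eval_elementary_def coeffs_of_int_mult frag_extend_cmul)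

lemma eval_elementary_one: "eval_elementary n 1 = 1"
proof -
  have "elementary_monom n 0 = 1" by (simp add: elementary_monom_def map_replicate_const del: upt_Suc)
  then show ?thesis using eval_elementary_of[of n 0] by simp
qed

lemma eval_elementary_mult: "eval_elementary n (p * q) = eval_elementary n p * eval_elementary n q"
  using subset_UNIV
proof (induction p rule: frag_induction)
  case (one \<mu>)
  show ?case using subset_UNIV
  proof (induction q rule: frag_induction)
    case (one \<nu>)
    then show ?case by (simp add: mult_single elementary_monom_add)
  qed (simp_all add: eval_elementary_diff algebra_simps)
qed (simp_all add: eval_elementary_diff algebra_simps)

lemma coeff_eval_elementary:
  "coeff (eval_elementary n p) m =
     (\<Sum>\<mu>\<in>Poly_Mapping.keys p. Poly_Mapping.lookup p \<mu> * coeff (elementary_monom n \<mu>) m)"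
  by (simp add: eval_elementary_def frag_extend_def lookup_sum)

lemma eval_elementary_in_typeD_polys:
  assumes "n \<ge> 2"
  shows "eval_elementary n p \<in> typeD_polys n"
  using subset_UNIV
proof (induction p rule: frag_induction)
  case zero
  then show ?case using typeD_polys_closed(2)[OF assms typeD_polys_closed(1)[OF assms] typeD_polys_closed(1)[OF assms]] by simp
qed (simp_all add: eval_elementary_diff typeD_polys_closed(2)[OF assms] elementary_monom_in_typeD_polys[OF assms])

text \<open>
  Among the monomials of \<open>p\<close> exactly one attains the maximal leading exponent, by injectivity of
  \<open>leading_exps\<close>. Its leading term cannot be cancelled by the others.
\<close>

lemma eval_elementary_eq_0:
  assumes n: "1 \<le> n" and p: "\<And>\<mu>. \<mu> \<in> Poly_Mapping.keys p \<Longrightarrow> Poly_Mapping.keys \<mu> \<subseteq> {1..n}"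
    and "eval_elementary n p = 0"
  shows "p = 0"
proof (rule ccontr)
  assume "p \<noteq> 0"
  define M where "M = Max (leading_exps n ` Poly_Mapping.keys p)"
  have "M \<in> leading_exps n ` Poly_Mapping.keys p"
    unfolding M_def by (rule Max_in) (use \<open>p \<noteq> 0\<close> in auto)
  then obtain \<mu>0 where \<mu>0: "\<mu>0 \<in> Poly_Mapping.keys p" "M = leading_exps n \<mu>0" by blast
  have "coeff (elementary_monom n \<mu>) M = 0" if \<mu>: "\<mu> \<in> Poly_Mapping.keys p" "\<mu> \<noteq> \<mu>0" for \<mu>
  proof -
    have "leading_exps n \<mu> \<le> M" unfolding M_def by (rule Max_ge) (use \<mu> in auto)
    moreover have "leading_exps n \<mu> \<noteq> M" using leading_exps_inj[OF n] \<mu>0 \<mu> p by blast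
    ultimately have "\<not> M \<le> leading_exps n \<mu>" by simp
    then have "M \<notin> support (elementary_monom n \<mu>)"
      using monic_at_elementary_monom[of n \<mu>] by (auto simp: monic_at_def)
    then show ?thesis by (simp add: in_keys_iff)
  qed
  then have "coeff (eval_elementary n p) M = (\<Sum>\<mu>\<in>Poly_Mapping.keys p.
      if \<mu> = \<mu>0 then Poly_Mapping.lookup p \<mu>0 * coeff (elementary_monom n \<mu>0) M else 0)"
    unfolding coeff_eval_elementary by (intro sum.cong refl) auto
  also have "\<dots> = Poly_Mapping.lookup p \<mu>0 * coeff (elementary_monom n \<mu>0) M"
    using \<mu>0 by simp
  also have "\<dots> \<noteq> 0"
    using \<mu>0 monic_at_elementary_monom[of n \<mu>0] by (auto simp: monic_at_def in_keys_iff)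
  finally show False using assms(3) by simp
qed

text \<open>
  With only finitely many variables, the order is the lexicographic order on lists of fixed length.
\<close>

lemma wf_exps_less:
  fixes n :: nat
  shows "wf {(a :: exps, b). a < b \<and> Poly_Mapping.keys a \<subseteq> {1..n} \<and> Poly_Mapping.keys b \<subseteq> {1..n}}" (is "wf ?R")
proof (rule wf_subset)
  show "wf (inv_image (lex less_than) (\<lambda>m. map (expo m) [1..<Suc n]))"
    by (intro wf_inv_image wf_lex wf_less_than)
  show "?R \<subseteq> inv_image (lex less_than) (\<lambda>m. map (expo m) [1..<Suc n])"
  proof (rule subrelI)
    fix a b assume "(a, b) \<in> ?R"
    then have "a < b" "Poly_Mapping.keys b \<subseteq> {1..n}" by auto
    then obtain k where k: "expo a k < expo b k" "\<And>k'. k' < k \<Longrightarrow> expo a k' = expo b k'"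
      unfolding exps_less_iff by blast
    have "k \<in> Poly_Mapping.keys b" using k(1) by (simp add: in_keys_iff)
    then have "1 \<le> k" "k \<le> n" using \<open>Poly_Mapping.keys b \<subseteq> {1..n}\<close> by auto
    then have split: "[1..<Suc n] = [1..<k] @ k # [Suc k..<Suc n]"
      by (metis le_SucI le_add_diff_inverse less_Suc_eq_le upt_add_eq_append upt_conv_Cons)
    have "map (expo b) [1..<k] = map (expo a) [1..<k]" using k(2) by auto
    then show "(a, b) \<in> inv_image (lex less_than) (\<lambda>m. map (expo m) [1..<Suc n])"
      unfolding in_inv_image lex_conv split using k(1) by fastforce
  qed
qed

text \<open>
  If two neighbouring exponents of the leading monomial were increasing, exchanging them would give a
  larger monomial with the same coefficient.
\<close>

lemma leading_exponent_dominant: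
  assumes "f \<in> typeD_polys n" "f \<noteq> 0"
  defines "m \<equiv> Max (support f)"
  shows "m \<in> support f" "Poly_Mapping.keys m \<subseteq> {1..n}"
    and "i \<in> {1..<n} \<Longrightarrow> even (expo m i + expo m (Suc i))"
    and "i \<in> {1..<n} \<Longrightarrow> expo m (Suc i) \<le> expo m i"
proof -
  show m: "m \<in> support f"
    unfolding m_def by (rule Max_in) (use assms(2) support_empty_iff in auto)
  show "Poly_Mapping.keys m \<subseteq> {1..n}" "i \<in> {1..<n} \<Longrightarrow> even (expo m i + expo m (Suc i))"
    using m assms(1) by (auto simp: typeD_polys_def skew_polys_def typeD_symmetric_def)
  show "expo m (Suc i) \<le> expo m i" if i: "i \<in> {1..<n}"
  proof (rule ccontr)
    assume "\<not> expo m (Suc i) \<le> expo m i"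
    then have "m < swap i m"
      unfolding exps_less_iff by (intro exI[of _ i]) (auto simp: transpose_def)
    moreover have "swap i m \<in> support f"
      using m assms(1) i by (simp add: typeD_polys_def typeD_symmetric_def in_keys_iff)
    then have "swap i m \<le> m" unfolding m_def by simp
    ultimately show False by simp
  qed
qed

text \<open>
  Subtracting the multiple of an elementary monomial with the same leading term stays inside the kernel
  and lowers the leading exponent, so the process ends.
\<close>

lemma eval_elementary_surj:
  assumes n: "n \<ge> 2" and f: "f \<in> typeD_polys n"
  shows "\<exists>p. (\<forall>\<mu>\<in>Poly_Mapping.keys p. Poly_Mapping.keys \<mu> \<subseteq> {1..n}) \<and> eval_elementary n p = f"
proof (cases "f = 0")
  case True
  then show ?thesis by (intro exI[of _ 0]) simp
next
  case False
  obtain m where "m = Max (support f)" by simp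
  from wf_exps_less[of n] this f False show ?thesis
  proof (induction m arbitrary: f)
    case (less m)
    note lead = leading_exponent_dominant[OF less.prems(2,3), folded less.prems(1)]
    obtain \<mu> where \<mu>: "Poly_Mapping.keys \<mu> \<subseteq> {1..n}" "leading_exps n \<mu> = m"
      using leading_exps_surj[of n m] lead(2-) n by auto
    define u where "u = coeff (elementary_monom n \<mu>) m"
    have mon: "monic_at (elementary_monom n \<mu>) m" using monic_at_elementary_monom[of n \<mu>] \<mu>(2) by simp
    then have u: "u * u = 1" unfolding u_def monic_at_def by (metis abs_mult_self_eq mult_1)
    define c where "c = coeff f m * u"
    define g where "g = f - of_int c * elementary_monom n \<mu>"
    have g: "g \<in> typeD_polys n"
      unfolding g_def by (intro typeD_polys_closed(2)[OF n] typeD_polys_of_int_mult elementary_monom_in_typeD_polys n less.prems)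
    have "coeff g m = 0" using u by (simp add: g_def c_def u_def[symmetric] mult.assoc)
    have below: "a < m" if "a \<in> support g" for a
    proof -
      have "a \<in> support f \<or> a \<in> support (elementary_monom n \<mu>)"
        using that by (auto simp: in_keys_iff g_def)
      then have "a \<le> m" using mon less.prems(1) by (auto simp: monic_at_def)
      moreover have "a \<noteq> m" using that \<open>coeff g m = 0\<close> by (auto simp: in_keys_iff)
      ultimately show ?thesis by simp
    qed
    have "\<exists>q. (\<forall>\<nu>\<in>Poly_Mapping.keys q. Poly_Mapping.keys \<nu> \<subseteq> {1..n}) \<and> eval_elementary n q = g"
    proof (cases "g = 0")
      case True
      then show ?thesis by (intro exI[of _ 0]) simp
    next
      case False
      note lead_g = leading_exponent_dominant[OF g False]
      show ?thesis
        by (rule less.IH[OF _ refl g False]) (use below[OF lead_g(1)] lead_g(2) lead(2) in simp)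
    qed
    then obtain q where q: "\<And>\<nu>. \<nu> \<in> Poly_Mapping.keys q \<Longrightarrow> Poly_Mapping.keys \<nu> \<subseteq> {1..n}" "eval_elementary n q = g"
      by blast
    have "eval_elementary n (q + frag_cmul c (frag_of \<mu>)) = f"
      by (simp add: eval_elementary_add eval_elementary_cmul q(2) g_def)
    moreover have "Poly_Mapping.keys \<nu> \<subseteq> {1..n}" if "\<nu> \<in> Poly_Mapping.keys (q + frag_cmul c (frag_of \<mu>))" for \<nu>
    proof -
      have "\<nu> \<in> Poly_Mapping.keys q \<or> \<nu> = \<mu>"
        using that Poly_Mapping.keys_add[of q "frag_cmul c (frag_of \<mu>)"] by auto
      then show ?thesis using q(1) \<mu>(1) by blast
    qed
    ultimately show ?case by blast
  qed
qed

section \<open>Skew polynomials as a quotient of the free ring\<close>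

definition skew_ring :: "nat \<Rightarrow> skew_poly ring" where
  "skew_ring n =
     \<lparr>carrier = skew_polys n, monoid.mult = (*), one = 1, ring.zero = 0, add = (+)\<rparr>"

lemma skew_ring_simps [simp]:
  "carrier (skew_ring n) = skew_polys n" "f \<otimes>\<^bsub>skew_ring n\<^esub> g = f * g" "\<one>\<^bsub>skew_ring n\<^esub> = 1"
  "\<zero>\<^bsub>skew_ring n\<^esub> = 0" "f \<oplus>\<^bsub>skew_ring n\<^esub> g = f + g"
  by (simp_all add: skew_ring_def)

lemma ring_skew_ring: "ring (skew_ring n)"
proof (rule ringI)
  show "abelian_group (skew_ring n)"
  proof (rule abelian_groupI)
    fix f assume "f \<in> carrier (skew_ring n)"
    then show "\<exists>g\<in>carrier (skew_ring n). g \<oplus>\<^bsub>skew_ring n\<^esub> f = \<zero>\<^bsub>skew_ring n\<^esub>"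
      by (intro bexI[of _ "- f"]) (auto intro: skew_polys_uminus)
  qed (auto simp: add_ac intro: skew_polys_add skew_polys_zero)
  show "Group.monoid (skew_ring n)"
    by (rule monoidI) (auto simp: mult.assoc intro: skew_polys_mult skew_polys_one)
qed (auto simp: algebra_simps)

lemma free_ring_simps:
  "carrier (free_ring n) = {p. \<forall>w\<in>Poly_Mapping.keys p. set (letters w) \<subseteq> {1..n}}"
  "p \<otimes>\<^bsub>free_ring n\<^esub> q = p * q" "\<one>\<^bsub>free_ring n\<^esub> = 1"
  "\<zero>\<^bsub>free_ring n\<^esub> = 0" "p \<oplus>\<^bsub>free_ring n\<^esub> q = p + q"
  by (simp_all add: free_ring_def)

lemma free_ring_a_inv:
  assumes "p \<in> carrier (free_ring n)"
  shows "\<ominus>\<^bsub>free_ring n\<^esub> p = - p"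
proof -
  interpret ring "free_ring n" by (rule ring_free_ring)
  show ?thesis using assms by (intro minus_equality) (auto simp: free_ring_simps)
qed

definition word_value :: "nat list \<Rightarrow> skew_poly" where
  "word_value w = prod_list (map X w)"

definition free_eval :: "(free_word \<Rightarrow>\<^sub>0 int) \<Rightarrow> skew_poly" where
  "free_eval p = Skew (frag_extend (\<lambda>w. coeffs (word_value (letters w))) p)"

lemma free_eval_of [simp]: "free_eval (frag_of w) = word_value (letters w)"
  by (simp add: free_eval_def)

lemma free_eval_add: "free_eval (p + q) = free_eval p + free_eval q"
  by (simp add: free_eval_def frag_extend_add plus_skew_poly_def)

lemma free_eval_diff: "free_eval (p - q) = free_eval p - free_eval q"
  by (simp add: free_eval_def frag_extend_diff minus_skew_poly_def)

lemma free_eval_zero [simp]: "free_eval 0 = 0"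
  using free_eval_diff[of 0 0] by simp

lemma free_eval_cmul: "free_eval (frag_cmul c p) = of_int c * free_eval p"
  by (rule skew_poly.expand) (simp add: free_eval_def coeffs_of_int_mult frag_extend_cmul)

lemma free_eval_one: "free_eval 1 = 1"
proof -
  have "free_eval (frag_of 0) = 1"
    unfolding free_eval_of by (simp add: word_value_def zero_free_word_def)
  then show ?thesis by simp
qed

lemma free_eval_mult: "free_eval (p * q) = free_eval p * free_eval q"
  using subset_UNIV
proof (induction p rule: frag_induction)
  case (one v)
  show ?case using subset_UNIV
  proof (induction q rule: frag_induction)
    case (one w)
    then show ?case by (simp add: mult_single word_value_def plus_free_word_def)
  qed (simp_all add: free_eval_diff algebra_simps)
qed (simp_all add: free_eval_diff algebra_simps)

lemma free_eval_var: "free_eval (free_var i) = X i"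
  by (simp add: free_var_def word_value_def)

lemma word_value_in_skew_polys:
  assumes "set w \<subseteq> {1..n}"
  shows "word_value w \<in> skew_polys n"
  unfolding word_value_def
proof (rule skew_polys_prod_list)
  fix f assume "f \<in> set (map X w)"
  then obtain i where "i \<in> set w" "f = X i" by auto
  with assms show "f \<in> skew_polys n" using skew_polys_X by blast
qed

lemma free_eval_in_skew_polys:
  assumes "p \<in> carrier (free_ring n)"
  shows "free_eval p \<in> skew_polys n"
proof -
  have "Poly_Mapping.keys p \<subseteq> {w. set (letters w) \<subseteq> {1..n}}"
    using assms by (auto simp: free_ring_simps)
  then show ?thesis
  proof (induction p rule: frag_induction)
    case (one w)
    then show ?case using word_value_in_skew_polys by simp
  qed (simp_all add: free_eval_diff skew_polys_zero skew_polys_diff)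
qed

lemma ring_hom_free_eval: "ring_hom_ring (free_ring n) (skew_ring n) free_eval"
  by (rule ring_hom_ringI)
    (use free_eval_in_skew_polys in \<open>auto simp: ring_free_ring ring_skew_ring free_ring_simps(2-)
      free_eval_mult free_eval_add free_eval_one\<close>)

lemma prod_list_increasing_monoms:
  assumes "sorted_wrt (<) ks"
  shows "prod_list (map (\<lambda>k. monom (Poly_Mapping.single k (c k))) ks) =
    monom (sum_list (map (\<lambda>k. Poly_Mapping.single k (c k)) ks))"
  using assms
proof (induction ks)
  case Nil
  then show ?case by (simp add: monom_zero)
next
  case (Cons k ks)
  let ?s = "sum_list (map (\<lambda>k. Poly_Mapping.single k (c k)) ks)"
  have "weight (\<lambda>j. of_bool (j < k)) ?s = 0"
    using Cons.prems by (induction ks) (auto simp: weight_add)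
  then have "reorder_sign (Poly_Mapping.single k (c k)) ?s = 1"
    by (simp add: reorder_sign_def inversions_def)
  then show ?case using Cons by (simp add: monom_mult)
qed

lemma X_power: "X i ^ c = monom (Poly_Mapping.single i c)"
proof (induction c)
  case (Suc c)
  have "reorder_sign (Poly_Mapping.single i 1) (Poly_Mapping.single i c) = 1"
    by (simp add: reorder_sign_def inversions_def)
  then show ?case
    using Suc by (simp add: X_def monom_mult flip: single_add)
qed (simp add: monom_zero)

text \<open>
  A normal form for words: modulo the anticommutation relations, every word equals one of these up to
  sign.
\<close>

definition sorted_word :: "nat \<Rightarrow> exps \<Rightarrow> nat list" where
  "sorted_word n a = concat (map (\<lambda>k. replicate (expo a k) k) [1..<Suc n])"

lemma set_sorted_word: "set (sorted_word n a) \<subseteq> {1..n}"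
  by (auto simp: sorted_word_def)

lemma word_value_sorted_word:
  assumes "Poly_Mapping.keys a \<subseteq> {1..n}"
  shows "word_value (sorted_word n a) = monom a"
proof -
  have "word_value (concat (map (\<lambda>k. replicate (expo a k) k) ks)) = prod_list (map (\<lambda>k. X k ^ expo a k) ks)" for ks
    by (induction ks) (auto simp: word_value_def)
  then have "word_value (sorted_word n a) =
      monom (sum_list (map (\<lambda>k. Poly_Mapping.single k (expo a k)) [1..<Suc n]))"
    unfolding sorted_word_def X_power by (simp only:) (rule prod_list_increasing_monoms, simp del: upt_Suc)
  also have "sum_list (map (\<lambda>k. Poly_Mapping.single k (expo a k)) [1..<Suc n]) = a"
  proof (rule poly_mapping_eqI)
    fix k
    have "sum_list (map (\<lambda>k. Poly_Mapping.single k (expo a k)) [1..<Suc n]) = (\<Sum>k\<in>{1..n}. Poly_Mapping.single k (expo a k))"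
      by (subst interv_sum_list_conv_sum_set_nat) (simp only: set_upt atLeastLessThanSuc_atLeastAtMost)
    moreover have "expo a k = 0" if "k \<notin> {1..n}" using that assms by (metis in_keys_iff subsetD)
    ultimately show "expo (sum_list (map (\<lambda>k. Poly_Mapping.single k (expo a k)) [1..<Suc n])) k = expo a k"
      by (simp add: lookup_sum lookup_single when_def)
  qed
  finally show ?thesis .
qed

lemma skew_polys_induct [consumes 1, case_names zero one X_mult diff]:
  assumes "f \<in> skew_polys n" and "P 0" and "P 1"
    and Xm: "\<And>i g. i \<in> {1..n} \<Longrightarrow> g \<in> skew_polys n \<Longrightarrow> P g \<Longrightarrow> P (X i * g)"
    and df: "\<And>f g. f \<in> skew_polys n \<Longrightarrow> g \<in> skew_polys n \<Longrightarrow> P f \<Longrightarrow> P g \<Longrightarrow> P (f - g)"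
  shows "P f"
proof -
  have word: "P (word_value w)" if "set w \<subseteq> {1..n}" for w
    using that
  proof (induction w)
    case (Cons i w)
    then have "i \<in> {1..n}" "set w \<subseteq> {1..n}" by auto
    then have "P (X i * word_value w)" by (intro Xm word_value_in_skew_polys Cons.IH)
    then show ?case by (simp add: word_value_def)
  qed (use \<open>P 1\<close> in \<open>simp add: word_value_def\<close>)
  have "support f \<subseteq> {m. Poly_Mapping.keys m \<subseteq> {1..n}}"
    using assms(1) by (auto simp: skew_polys_def)
  then have "f \<in> skew_polys n \<and> P f"
  proof (induction f rule: skew_poly_induct)
    case (monom a)
    then show ?case
      using word[OF set_sorted_word, of a] by (simp add: word_value_sorted_word skew_polys_monom)
  qed (auto simp: skew_polys_zero \<open>P 0\<close> intro: df skew_polys_diff)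
  then show ?thesis ..
qed

lemma ideal_Pol_ideal: "ideal (Pol_ideal n) (free_ring n)"
  and anticommutator_in_Pol_ideal: "i \<in> {1..n} \<Longrightarrow> j \<in> {1..n} \<Longrightarrow> i \<noteq> j \<Longrightarrow>
    free_var i * free_var j + free_var j * free_var i \<in> Pol_ideal n"
proof -
  interpret ring "free_ring n" by (rule ring_free_ring)
  let ?G = "{free_var i * free_var j + free_var j * free_var i | i j.
           i \<in> {1..n} \<and> j \<in> {1..n} \<and> i \<noteq> j}"
  have "free_var i * free_var j + free_var j * free_var i \<in> carrier (free_ring n)"
    if "i \<in> {1..n}" "j \<in> {1..n}" for i j
    using a_closed[OF m_closed m_closed, of "free_var i" "free_var j" "free_var j" "free_var i"]
      free_var_closed that by (simp add: free_ring_simps(2-))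
  then have G: "?G \<subseteq> carrier (free_ring n)" by blast
  show "ideal (Pol_ideal n) (free_ring n)"
    unfolding Pol_ideal_def by (rule genideal_ideal[OF G])
  show "i \<in> {1..n} \<Longrightarrow> j \<in> {1..n} \<Longrightarrow> i \<noteq> j \<Longrightarrow>
      free_var i * free_var j + free_var j * free_var i \<in> Pol_ideal n"
    unfolding Pol_ideal_def using genideal_self[OF G] by blast
qed

lemma X_anticommute:
  assumes "i \<noteq> j"
  shows "X i * X j + X j * X i = 0"
proof -
  have "reorder_sign (Poly_Mapping.single i 1) (Poly_Mapping.single j 1) =
      - reorder_sign (Poly_Mapping.single j 1) (Poly_Mapping.single i 1)"
    using assms by (cases "i < j") (simp_all add: reorder_sign_def inversions_def)
  then show ?thesis
    unfolding X_def monom_mult by (simp add: add.commute)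
qed

lemma Pol_ideal_le_kernel: "Pol_ideal n \<subseteq> a_kernel (free_ring n) (skew_ring n) free_eval"
proof -
  interpret ring_hom_ring "free_ring n" "skew_ring n" free_eval by (rule ring_hom_free_eval)
  show ?thesis
    unfolding Pol_ideal_def
  proof (rule R.genideal_minimal[OF kernel_is_ideal], clarify)
    fix i j assume ij: "i \<in> {1..n}" "j \<in> {1..n}" "i \<noteq> j"
    have "free_var i * free_var j + free_var j * free_var i \<in> carrier (free_ring n)"
      using R.a_closed[OF R.m_closed R.m_closed, of "free_var i" "free_var j" "free_var j" "free_var i"]
        free_var_closed ij by (simp add: free_ring_simps(2-))
    moreover have "free_eval (free_var i * free_var j + free_var j * free_var i) = 0"
      by (simp only: free_eval_add free_eval_mult free_eval_var X_anticommute[OF ij(3)])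
    ultimately show "free_var i * free_var j + free_var j * free_var i \<in> a_kernel (free_ring n) (skew_ring n) free_eval"
      unfolding a_kernel_def' skew_ring_simps by blast
  qed
qed

lemma Pol_ideal_closed:
  assumes "p \<in> Pol_ideal n"
  shows "- p \<in> Pol_ideal n"
    and "q \<in> Pol_ideal n \<Longrightarrow> p + q \<in> Pol_ideal n"
    and "q \<in> Pol_ideal n \<Longrightarrow> p - q \<in> Pol_ideal n"
    and "r \<in> carrier (free_ring n) \<Longrightarrow> r * p \<in> Pol_ideal n"
    and "r \<in> carrier (free_ring n) \<Longrightarrow> p * r \<in> Pol_ideal n"
proof -
  interpret ideal "Pol_ideal n" "free_ring n" by (rule ideal_Pol_ideal)
  have neg: "- p \<in> Pol_ideal n" if "p \<in> Pol_ideal n" for p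
  proof -
    have "- 1 \<in> carrier (free_ring n)" by (simp add: free_ring_simps zero_free_word_def)
    from I_l_closed[OF that this] show ?thesis by (simp add: free_ring_simps)
  qed
  show "- p \<in> Pol_ideal n" using neg[OF assms] .
  show add: "p + q \<in> Pol_ideal n" if "q \<in> Pol_ideal n" for q
    using additive_subgroup.a_closed[OF is_additive_subgroup assms that] by (simp add: free_ring_simps)
  show "p - q \<in> Pol_ideal n" if "q \<in> Pol_ideal n" for q
    using add[OF neg[OF that]] by simp
  show "r * p \<in> Pol_ideal n" "p * r \<in> Pol_ideal n" if "r \<in> carrier (free_ring n)"
    using I_l_closed[OF assms that] I_r_closed[OF assms that] by (simp_all add: free_ring_simps)
qed

text \<open>
  Congruence of words up to a sign. The sign need not be tracked, since it can be read off in the model.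
\<close>

definition word_congruent :: "nat \<Rightarrow> nat list \<Rightarrow> nat list \<Rightarrow> bool" where
  "word_congruent n v w \<longleftrightarrow>
     (\<exists>c. c \<in> {1, - 1} \<and> frag_of (Word v) - frag_cmul c (frag_of (Word w)) \<in> Pol_ideal n)"

lemma word_congruent_refl: "word_congruent n w w"
proof -
  have "0 \<in> Pol_ideal n"
    using ideal.axioms(1)[OF ideal_Pol_ideal, THEN additive_subgroup.zero_closed]
    by (simp add: free_ring_simps)
  then show ?thesis unfolding word_congruent_def by (intro exI[of _ 1]) simp
qed

lemma word_congruent_trans:
  assumes "word_congruent n u v" "word_congruent n v w"
  shows "word_congruent n u w"
proof -
  obtain c d where c: "c \<in> {1, - 1}" "frag_of (Word u) - frag_cmul c (frag_of (Word v)) \<in> Pol_ideal n"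
    and d: "d \<in> {1, - 1}" "frag_of (Word v) - frag_cmul d (frag_of (Word w)) \<in> Pol_ideal n"
    using assms unfolding word_congruent_def by blast
  have "frag_cmul c (frag_of (Word v) - frag_cmul d (frag_of (Word w))) \<in> Pol_ideal n"
    using c(1) Pol_ideal_closed(1)[OF d(2)] d(2) by auto
  moreover have "frag_cmul c (frag_of (Word v) - frag_cmul d (frag_of (Word w))) =
      frag_cmul c (frag_of (Word v)) - frag_cmul (c * d) (frag_of (Word w))"
    by (rule poly_mapping_eqI) (simp add: lookup_minus algebra_simps)
  ultimately have "frag_cmul c (frag_of (Word v)) - frag_cmul (c * d) (frag_of (Word w)) \<in> Pol_ideal n"
    by (simp only:)
  from Pol_ideal_closed(2)[OF c(2) this]
  have "frag_of (Word u) - frag_cmul (c * d) (frag_of (Word w)) \<in> Pol_ideal n"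
    by (simp only: add_diff_eq diff_add_cancel)
  moreover have "c * d \<in> {1, - 1}" using c(1) d(1) by auto
  ultimately show ?thesis unfolding word_congruent_def by blast
qed

lemma word_congruent_context:
  assumes "word_congruent n v w" "set u \<subseteq> {1..n}" "set u' \<subseteq> {1..n}"
  shows "word_congruent n (u @ v @ u') (u @ w @ u')"
proof -
  obtain c where c: "c \<in> {1, - 1}" "frag_of (Word v) - frag_cmul c (frag_of (Word w)) \<in> Pol_ideal n"
    using assms(1) unfolding word_congruent_def by blast
  have carr: "frag_of (Word u) \<in> carrier (free_ring n)" "frag_of (Word u') \<in> carrier (free_ring n)"
    using assms(2,3) by (simp_all add: free_ring_simps)
  have word: "frag_of (Word u) * frag_of (Word v) * frag_of (Word u') = frag_of (Word (u @ v @ u'))" for v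
    by (simp add: mult_single plus_free_word_def)
  have "frag_of (Word u) * (frag_of (Word v) - frag_cmul c (frag_of (Word w))) * frag_of (Word u') \<in> Pol_ideal n"
    by (intro Pol_ideal_closed(4,5) c carr)
  also have "frag_of (Word u) * (frag_of (Word v) - frag_cmul c (frag_of (Word w))) * frag_of (Word u') =
      frag_of (Word (u @ v @ u')) - frag_cmul c (frag_of (Word (u @ w @ u')))"
    using c(1) word[of v] word[of w] by (auto simp: algebra_simps)
  finally show ?thesis using c(1) unfolding word_congruent_def by blast
qed

lemma word_congruent_swap:
  assumes "i \<in> {1..n}" "j \<in> {1..n}"
  shows "word_congruent n [i, j] [j, i]"
proof (cases "i = j")
  case False
  have "frag_of (Word [i, j]) + frag_of (Word [j, i]) \<in> Pol_ideal n"
    using anticommutator_in_Pol_ideal[OF assms False]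
    by (simp add: free_var_def mult_single plus_free_word_def)
  then show ?thesis unfolding word_congruent_def by (intro exI[of _ "- 1"]) simp
qed (simp add: word_congruent_refl)

lemma word_congruent_move:
  assumes "i \<in> {1..n}" "set u \<subseteq> {1..n}"
  shows "word_congruent n (i # u) (u @ [i])"
  using assms(2)
proof (induction u)
  case (Cons j u)
  have "word_congruent n (i # j # u) (j # i # u)"
    using word_congruent_context[OF word_congruent_swap[OF assms(1), of j], of "[]" u] Cons.prems by simp
  also have "word_congruent n (j # i # u) (j # u @ [i])"
    using word_congruent_context[OF Cons.IH, of "[j]" "[]"] Cons.prems by simp
  finally (word_congruent_trans) show ?case by simp
qed (simp add: word_congruent_refl)

text \<open>
  Insertion sort: after sorting the tail, the first letter is moved past all smaller letters.
\<close>

lemma word_congruent_sorted_word: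
  assumes "set w \<subseteq> {1..n}"
  shows "\<exists>a. Poly_Mapping.keys a \<subseteq> {1..n} \<and> word_congruent n w (sorted_word n a)"
  using assms
proof (induction w)
  case Nil
  have "sorted_word n 0 = []" by (simp add: sorted_word_def)
  then show ?case using word_congruent_refl[of n "[]"] by (intro exI[of _ 0]) simp
next
  case (Cons i w)
  then obtain a where a: "Poly_Mapping.keys a \<subseteq> {1..n}" "word_congruent n w (sorted_word n a)" by auto
  have i: "i \<in> {1..n}" using Cons.prems by simp
  define u where "u = concat (map (\<lambda>k. replicate (expo a k) k) [1..<i])"
  define v where "v = concat (map (\<lambda>k. replicate (expo a k) k) [i..<Suc n])"
  let ?b = "Poly_Mapping.single i 1 + a"
  have upt: "[1..<Suc n] = [1..<i] @ [i..<Suc n]" "[i..<Suc n] = i # [Suc i..<Suc n]"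
  proof -
    show "[1..<Suc n] = [1..<i] @ [i..<Suc n]"
      using i by (metis atLeastAtMost_iff le_SucI le_add_diff_inverse upt_add_eq_append)
    show "[i..<Suc n] = i # [Suc i..<Suc n]" using i by (intro upt_conv_Cons) simp
  qed
  have sw: "sorted_word n a = u @ v"
    unfolding sorted_word_def upt(1) u_def v_def by (simp del: upt_Suc)
  have off: "map (\<lambda>k. replicate (expo ?b k) k) ks = map (\<lambda>k. replicate (expo a k) k) ks" if "i \<notin> set ks" for ks
    using that by (auto simp: lookup_add lookup_single when_def)
  have at: "replicate (expo ?b i) i = i # replicate (expo a i) i" by (simp add: lookup_add)
  have off': "map (\<lambda>k. replicate (expo ?b k) k) [1..<i] = map (\<lambda>k. replicate (expo a k) k) [1..<i]"
    "map (\<lambda>k. replicate (expo ?b k) k) [Suc i..<Suc n] = map (\<lambda>k. replicate (expo a k) k) [Suc i..<Suc n]"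
    by (rule off, simp)+
  have sb: "sorted_word n ?b = u @ i # v"
    unfolding sorted_word_def upt(1) u_def v_def
    unfolding upt(2) map_append concat_append list.map concat.simps off' at append_Cons ..
  have uv: "set u \<subseteq> {1..n}" "set v \<subseteq> {1..n}"
    using set_sorted_word[of n a] sw by auto
  have "word_congruent n (i # w) (i # u @ v)"
    using word_congruent_context[OF a(2), of "[i]" "[]"] i sw by simp
  also have "word_congruent n (i # u @ v) (u @ i # v)"
    using word_congruent_context[OF word_congruent_move[OF i uv(1)], of "[]" v] uv by simp
  finally (word_congruent_trans) have "word_congruent n (i # w) (sorted_word n ?b)" by (simp only: sb)
  moreover have "Poly_Mapping.keys ?b \<subseteq> {1..n}"
    using a(1) i Poly_Mapping.keys_add[of "Poly_Mapping.single i 1" a] by auto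
  ultimately show ?case by blast
qed

text \<open>
  Let \<open>\<sigma>\<close> send a monomial to its sorted word. A word is congruent to plus or minus a sorted word modulo
  the ideal, and \<open>free_eval\<close> records the same sign, so \<open>p\<close> and \<open>\<sigma> (free_eval p)\<close> are congruent. If
  \<open>free_eval p = 0\<close>, then \<open>p\<close> lies in the ideal.
\<close>

lemma kernel_free_eval: "a_kernel (free_ring n) (skew_ring n) free_eval = Pol_ideal n"
proof (rule subset_antisym[OF _ Pol_ideal_le_kernel], rule subsetI)
  fix p assume p: "p \<in> a_kernel (free_ring n) (skew_ring n) free_eval"
  define \<sigma> where "\<sigma> f = frag_extend (\<lambda>a. frag_of (Word (sorted_word n a))) (coeffs f)" for f
  have \<sigma>_diff: "\<sigma> (f - g) = \<sigma> f - \<sigma> g" for f g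
    by (simp add: \<sigma>_def minus_skew_poly_def frag_extend_diff)
  have "Poly_Mapping.keys p \<subseteq> {w. set (letters w) \<subseteq> {1..n}}"
    using p by (auto simp: a_kernel_def' free_ring_simps)
  then have "p - \<sigma> (free_eval p) \<in> Pol_ideal n"
  proof (induction p rule: frag_induction)
    case zero
    have "0 \<in> Pol_ideal n"
      using ideal.axioms(1)[OF ideal_Pol_ideal, THEN additive_subgroup.zero_closed]
      by (simp add: free_ring_simps)
    then show ?case by (simp add: \<sigma>_def zero_skew_poly_def)
  next
    case (one w)
    then obtain a where a: "Poly_Mapping.keys a \<subseteq> {1..n}" "word_congruent n (letters w) (sorted_word n a)"
      using word_congruent_sorted_word by blast
    then obtain c where c: "frag_of w - frag_cmul c (frag_of (Word (sorted_word n a))) \<in> Pol_ideal n"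
      unfolding word_congruent_def by auto
    have "free_eval (frag_of w - frag_cmul c (frag_of (Word (sorted_word n a)))) = 0"
      using c Pol_ideal_le_kernel by (auto simp: a_kernel_def')
    then have "free_eval (frag_of w) = of_int c * monom a"
      by (simp add: free_eval_diff free_eval_cmul word_value_sorted_word[OF a(1)])
    then have "\<sigma> (free_eval (frag_of w)) = frag_cmul c (frag_of (Word (sorted_word n a)))"
      by (simp only: \<sigma>_def coeffs_of_int_mult frag_extend_cmul) (simp add: monom_def)
    then show ?case using c by (simp only:)
  next
    case (diff p q)
    have "p - q - \<sigma> (free_eval (p - q)) = (p - \<sigma> (free_eval p)) - (q - \<sigma> (free_eval q))"
      by (simp add: free_eval_diff \<sigma>_diff)
    then show ?case using Pol_ideal_closed(3)[OF diff] by (simp only:)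
  qed
  moreover have "\<sigma> (free_eval p) = 0"
    using p by (simp add: a_kernel_def' \<sigma>_def zero_skew_poly_def)
  ultimately show "p \<in> Pol_ideal n" by simp
qed

lemma free_eval_surj: "free_eval ` carrier (free_ring n) = skew_polys n"
proof
  show "free_eval ` carrier (free_ring n) \<subseteq> skew_polys n"
    using free_eval_in_skew_polys by blast
  interpret ring "free_ring n" by (rule ring_free_ring)
  show "skew_polys n \<subseteq> free_eval ` carrier (free_ring n)"
  proof
    fix f assume "f \<in> skew_polys n"
    then show "f \<in> free_eval ` carrier (free_ring n)"
    proof (induction f rule: skew_polys_induct)
      case zero
      then show ?case using zero_closed by (intro image_eqI[of _ _ 0]) (simp_all add: free_ring_simps)
    next
      case one
      then show ?case using one_closed by (intro image_eqI[of _ _ 1]) (simp_all add: free_eval_one free_ring_simps(2-))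
    next
      case (X_mult i g)
      then obtain p where "p \<in> carrier (free_ring n)" "g = free_eval p" by blast
      then show ?case
        using m_closed[OF free_var_closed[OF X_mult(1)], of p]
        by (intro image_eqI[of _ _ "free_var i * p"]) (simp_all add: free_eval_mult free_eval_var free_ring_simps(2-))
    next
      case (diff f g)
      then obtain p q where "p \<in> carrier (free_ring n)" "f = free_eval p" "q \<in> carrier (free_ring n)" "g = free_eval q" by blast
      then show ?case
        using minus_closed[of p q]
        by (intro image_eqI[of _ _ "p - q"]) (simp_all add: free_eval_diff a_minus_def free_ring_a_inv free_ring_simps(2-))
    qed
  qed
qed

text \<open>
  The map induced by \<open>free_eval\<close> on cosets.
\<close>

definition to_skew :: "(free_word \<Rightarrow>\<^sub>0 int) set \<Rightarrow> skew_poly" where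
  "to_skew x = the_elem (free_eval ` x)"

lemma to_skew_iso: "to_skew \<in> ring_iso (Pol n) (skew_ring n)"
proof -
  interpret ring_hom_ring "free_ring n" "skew_ring n" free_eval by (rule ring_hom_free_eval)
  have "(\<lambda>x. the_elem (free_eval ` x)) \<in>
      ring_iso (free_ring n Quot a_kernel (free_ring n) (skew_ring n) free_eval) (skew_ring n)"
    by (rule FactRing_iso_set) (simp add: free_eval_surj)
  then show ?thesis by (simp add: kernel_free_eval Pol_def to_skew_def[abs_def])
qed

lemma to_skew_var:
  assumes "i \<in> {1..n}"
  shows "to_skew (Pol_var n i) = X i"
proof -
  interpret ring_hom_ring "free_ring n" "skew_ring n" free_eval by (rule ring_hom_free_eval)
  show ?thesis
    using the_elem_simp[OF free_var_closed[OF assms]]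
    by (simp add: kernel_free_eval Pol_var_def to_skew_def free_eval_var)
qed

section \<open>Transport between the quotient and the model\<close>

lemma to_skew_bij: "bij_betw to_skew (carrier (Pol n)) (skew_polys n)"
  using ring_iso_memE(5)[OF to_skew_iso[of n]] by simp

lemma to_skew_closed: "x \<in> carrier (Pol n) \<Longrightarrow> to_skew x \<in> skew_polys n"
  using to_skew_bij bij_betwE by blast

lemma to_skew_eqI:
  "x \<in> carrier (Pol n) \<Longrightarrow> y \<in> carrier (Pol n) \<Longrightarrow> to_skew x = to_skew y \<Longrightarrow> x = y"
  using to_skew_bij[of n] by (auto simp: bij_betw_def dest: inj_onD)

lemma to_skew_mult:
    "x \<in> carrier (Pol n) \<Longrightarrow> y \<in> carrier (Pol n) \<Longrightarrow> to_skew (x \<otimes>\<^bsub>Pol n\<^esub> y) = to_skew x * to_skew y"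
  and to_skew_add:
    "x \<in> carrier (Pol n) \<Longrightarrow> y \<in> carrier (Pol n) \<Longrightarrow> to_skew (x \<oplus>\<^bsub>Pol n\<^esub> y) = to_skew x + to_skew y"
  and to_skew_one: "to_skew \<one>\<^bsub>Pol n\<^esub> = 1"
  using ring_iso_memE(2,3,4)[OF to_skew_iso[of n]] by simp_all

lemma to_skew_zero: "to_skew \<zero>\<^bsub>Pol n\<^esub> = 0"
proof -
  interpret ring "Pol n" by (rule ring_Pol)
  have "to_skew \<zero>\<^bsub>Pol n\<^esub> = to_skew \<zero>\<^bsub>Pol n\<^esub> + to_skew \<zero>\<^bsub>Pol n\<^esub>"
    using to_skew_add[OF zero_closed zero_closed] by simp
  then show ?thesis by simp
qed

lemma to_skew_a_inv:
  assumes "x \<in> carrier (Pol n)"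
  shows "to_skew (\<ominus>\<^bsub>Pol n\<^esub> x) = - to_skew x"
proof -
  interpret ring "Pol n" by (rule ring_Pol)
  have "to_skew (\<ominus>\<^bsub>Pol n\<^esub> x) + to_skew x = 0"
    using to_skew_add[OF a_inv_closed[OF assms] assms] by (simp add: l_neg[OF assms] to_skew_zero)
  then show ?thesis by (simp add: eq_neg_iff_add_eq_0)
qed

lemma to_skew_diff:
  assumes "x \<in> carrier (Pol n)" "y \<in> carrier (Pol n)"
  shows "to_skew (x \<ominus>\<^bsub>Pol n\<^esub> y) = to_skew x - to_skew y"
proof -
  interpret ring "Pol n" by (rule ring_Pol)
  show ?thesis
    using assms by (simp add: a_minus_def to_skew_add to_skew_a_inv)
qed

definition from_skew :: "nat \<Rightarrow> skew_poly \<Rightarrow> (free_word \<Rightarrow>\<^sub>0 int) set" where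
  "from_skew n = inv_into (carrier (Pol n)) to_skew"

lemma from_skew_closed: "f \<in> skew_polys n \<Longrightarrow> from_skew n f \<in> carrier (Pol n)"
  and to_skew_from_skew: "f \<in> skew_polys n \<Longrightarrow> to_skew (from_skew n f) = f"
  and from_skew_to_skew: "x \<in> carrier (Pol n) \<Longrightarrow> from_skew n (to_skew x) = x"
  using to_skew_bij[of n] unfolding from_skew_def bij_betw_def
  by (auto simp: inv_into_into f_inv_into_f)

lemma Pol_var_closed: "i \<in> {1..n} \<Longrightarrow> Pol_var n i \<in> carrier (Pol n)"
  using free_var_closed[of i n] by (auto simp: Pol_def Pol_var_def FactRing_def A_RCOSETS_def')

lemma Pol_induct [consumes 1, case_names zero one var_mult diff]:
  assumes "x \<in> carrier (Pol n)" and "P \<zero>\<^bsub>Pol n\<^esub>" and "P \<one>\<^bsub>Pol n\<^esub>"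
    and Xm: "\<And>i y. i \<in> {1..n} \<Longrightarrow> y \<in> carrier (Pol n) \<Longrightarrow> P y \<Longrightarrow> P (Pol_var n i \<otimes>\<^bsub>Pol n\<^esub> y)"
    and df: "\<And>y z. y \<in> carrier (Pol n) \<Longrightarrow> z \<in> carrier (Pol n) \<Longrightarrow> P y \<Longrightarrow> P z \<Longrightarrow> P (y \<ominus>\<^bsub>Pol n\<^esub> z)"
  shows "P x"
proof -
  interpret ring "Pol n" by (rule ring_Pol)
  have "P (from_skew n f)" if "f \<in> skew_polys n" for f
    using that
  proof (induction f rule: skew_polys_induct)
    case zero
    have "from_skew n 0 = \<zero>\<^bsub>Pol n\<^esub>" using from_skew_to_skew[OF zero_closed] by (simp add: to_skew_zero)
    then show ?case using assms(2) by simp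
  next
    case one
    have "from_skew n 1 = \<one>\<^bsub>Pol n\<^esub>" using from_skew_to_skew[OF one_closed] by (simp add: to_skew_one)
    then show ?case using assms(3) by simp
  next
    case (X_mult i g)
    have "from_skew n (X i * g) = Pol_var n i \<otimes>\<^bsub>Pol n\<^esub> from_skew n g"
      using from_skew_to_skew[OF m_closed[OF Pol_var_closed from_skew_closed], of i g] X_mult(1,2)
      by (simp add: to_skew_mult Pol_var_closed from_skew_closed to_skew_var to_skew_from_skew)
    then show ?case using Xm X_mult by (simp add: from_skew_closed)
  next
    case (diff f g)
    have "from_skew n (f - g) = from_skew n f \<ominus>\<^bsub>Pol n\<^esub> from_skew n g"
      using from_skew_to_skew[OF minus_closed[OF from_skew_closed from_skew_closed], of f g] diff(1,2)
      by (simp add: to_skew_diff from_skew_closed to_skew_from_skew)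
    then show ?case using df diff by (simp add: from_skew_closed)
  qed
  from this[OF to_skew_closed[OF assms(1)]] show ?thesis
    using assms(1) by (simp only: from_skew_to_skew)
qed

lemma additive_hom_zero_diff:
  assumes "ring R" "h \<in> hom (add_monoid R) (add_monoid R)"
  shows "h \<zero>\<^bsub>R\<^esub> = \<zero>\<^bsub>R\<^esub>"
    and "x \<in> carrier R \<Longrightarrow> y \<in> carrier R \<Longrightarrow> h (x \<ominus>\<^bsub>R\<^esub> y) = h x \<ominus>\<^bsub>R\<^esub> h y"
proof -
  interpret ring R by fact
  interpret h: group_hom "add_monoid R" "add_monoid R" h
    by (intro group_hom.intro group_hom_axioms.intro assms(2) a_group)
  show "h \<zero>\<^bsub>R\<^esub> = \<zero>\<^bsub>R\<^esub>" using h.hom_one by simp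
  show "h (x \<ominus>\<^bsub>R\<^esub> y) = h x \<ominus>\<^bsub>R\<^esub> h y" if "x \<in> carrier R" "y \<in> carrier R"
    using h.hom_mult[of x "\<ominus>\<^bsub>R\<^esub> y"] h.hom_inv[of y] that by (simp add: a_minus_def a_inv_def)
qed

text \<open>
  Common core of the uniqueness of ring endomorphisms and of twisted derivations with given values on
  the variables: every element arises from 1 by multiplying with variables from the left and
  subtracting.
\<close>

lemma additive_map_eqI:
  assumes h: "h \<in> hom (add_monoid (Pol n)) (add_monoid (Pol n))" "h \<in> extensional (carrier (Pol n))"
    and k: "k \<in> hom (add_monoid (Pol n)) (add_monoid (Pol n))" "k \<in> extensional (carrier (Pol n))"
    and one: "h \<one>\<^bsub>Pol n\<^esub> = k \<one>\<^bsub>Pol n\<^esub>"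
    and step: "\<And>i y. i \<in> {1..n} \<Longrightarrow> y \<in> carrier (Pol n) \<Longrightarrow> h y = k y \<Longrightarrow>
      h (Pol_var n i \<otimes>\<^bsub>Pol n\<^esub> y) = k (Pol_var n i \<otimes>\<^bsub>Pol n\<^esub> y)"
  shows "h = k"
proof (rule extensionalityI[OF h(2) k(2)])
  fix x assume "x \<in> carrier (Pol n)"
  then show "h x = k x"
  proof (induction x rule: Pol_induct)
    case zero
    show ?case by (simp only: additive_hom_zero_diff(1)[OF ring_Pol h(1)] additive_hom_zero_diff(1)[OF ring_Pol k(1)])
  next
    case (diff y z)
    then show ?case
      by (simp only: additive_hom_zero_diff(2)[OF ring_Pol h(1)] additive_hom_zero_diff(2)[OF ring_Pol k(1)])
  qed (simp_all add: one step)
qed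

lemma ring_hom_additive: "h \<in> ring_hom R S \<Longrightarrow> h \<in> hom (add_monoid R) (add_monoid S)"
  by (auto simp: ring_hom_def hom_def)

lemma Pol_ring_hom_eqI:
  assumes "h \<in> ring_hom (Pol n) (Pol n)" "h \<in> extensional (carrier (Pol n))"
    and "k \<in> ring_hom (Pol n) (Pol n)" "k \<in> extensional (carrier (Pol n))"
    and "\<And>i. i \<in> {1..n} \<Longrightarrow> h (Pol_var n i) = k (Pol_var n i)"
  shows "h = k"
proof (rule additive_map_eqI)
  show "h \<one>\<^bsub>Pol n\<^esub> = k \<one>\<^bsub>Pol n\<^esub>"
    by (simp only: ring_hom_one[OF assms(1)] ring_hom_one[OF assms(3)])
  fix i y assume "i \<in> {1..n}" "y \<in> carrier (Pol n)" "h y = k y"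
  then show "h (Pol_var n i \<otimes>\<^bsub>Pol n\<^esub> y) = k (Pol_var n i \<otimes>\<^bsub>Pol n\<^esub> y)"
    by (simp only: ring_hom_mult[OF assms(1) Pol_var_closed] ring_hom_mult[OF assms(3) Pol_var_closed] assms(5))
qed (intro ring_hom_additive assms)+

lemma twisted_derivation_eqI:
  assumes "twisted_derivation (Pol n) s h" "h \<in> extensional (carrier (Pol n))"
    and "twisted_derivation (Pol n) s k" "k \<in> extensional (carrier (Pol n))"
    and "\<And>i. i \<in> {1..n} \<Longrightarrow> h (Pol_var n i) = k (Pol_var n i)"
  shows "h = k"
proof (rule additive_map_eqI)
  have *: "d \<in> hom (add_monoid (Pol n)) (add_monoid (Pol n))" "d \<one>\<^bsub>Pol n\<^esub> = \<zero>\<^bsub>Pol n\<^esub>"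
    "i \<in> {1..n} \<Longrightarrow> y \<in> carrier (Pol n) \<Longrightarrow> d (Pol_var n i \<otimes>\<^bsub>Pol n\<^esub> y) =
       d (Pol_var n i) \<otimes>\<^bsub>Pol n\<^esub> y \<oplus>\<^bsub>Pol n\<^esub> s (Pol_var n i) \<otimes>\<^bsub>Pol n\<^esub> d y"
    if "twisted_derivation (Pol n) s d" for d i y
    using that Pol_var_closed[of i n] unfolding twisted_derivation_def by blast+
  show "h \<in> hom (add_monoid (Pol n)) (add_monoid (Pol n))" "k \<in> hom (add_monoid (Pol n)) (add_monoid (Pol n))"
    by (rule *(1)[OF assms(1)], rule *(1)[OF assms(3)])
  show "h \<one>\<^bsub>Pol n\<^esub> = k \<one>\<^bsub>Pol n\<^esub>"
    by (simp only: *(2)[OF assms(1)] *(2)[OF assms(3)])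
  fix i y assume "i \<in> {1..n}" "y \<in> carrier (Pol n)" "h y = k y"
  then show "h (Pol_var n i \<otimes>\<^bsub>Pol n\<^esub> y) = k (Pol_var n i \<otimes>\<^bsub>Pol n\<^esub> y)"
    by (simp only: *(3)[OF assms(1)] *(3)[OF assms(3)] assms(5))
qed (fact assms)+

definition transport :: "nat \<Rightarrow> (skew_poly \<Rightarrow> skew_poly) \<Rightarrow> (free_word \<Rightarrow>\<^sub>0 int) set \<Rightarrow> (free_word \<Rightarrow>\<^sub>0 int) set" where
  "transport n h = restrict (\<lambda>x. from_skew n (h (to_skew x))) (carrier (Pol n))"

lemma transport_extensional: "transport n h \<in> extensional (carrier (Pol n))"
  by (simp add: transport_def)

lemma transport_closed:
  assumes "\<And>f. f \<in> skew_polys n \<Longrightarrow> h f \<in> skew_polys n" "x \<in> carrier (Pol n)"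
  shows "transport n h x \<in> carrier (Pol n)"
    and "to_skew (transport n h x) = h (to_skew x)"
  using assms by (simp_all add: transport_def from_skew_closed to_skew_from_skew to_skew_closed)

lemma transport_ring_hom:
  assumes closed: "\<And>f. f \<in> skew_polys n \<Longrightarrow> h f \<in> skew_polys n"
    and "\<And>f g. h (f + g) = h f + h g" "\<And>f g. h (f * g) = h f * h g" "h 1 = 1"
  shows "transport n h \<in> ring_hom (Pol n) (Pol n)"
proof -
  interpret ring "Pol n" by (rule ring_Pol)
  note tr = transport_closed[OF closed]
  show ?thesis
    by (rule ring_hom_memI; (rule to_skew_eqI[of _ n])?)
      (simp_all add: tr assms to_skew_add to_skew_mult to_skew_one)
qed

lemma transport_twisted_derivation:
  assumes s: "\<And>f. f \<in> skew_polys n \<Longrightarrow> s f \<in> skew_polys n"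
    and d: "\<And>f. f \<in> skew_polys n \<Longrightarrow> d f \<in> skew_polys n"
    and "\<And>f g. f \<in> skew_polys n \<Longrightarrow> g \<in> skew_polys n \<Longrightarrow> d (f + g) = d f + d g" "d 1 = 0"
    and "\<And>f g. f \<in> skew_polys n \<Longrightarrow> g \<in> skew_polys n \<Longrightarrow> d (f * g) = d f * g + s f * d g"
  shows "twisted_derivation (Pol n) (transport n s) (transport n d)"
proof -
  interpret ring "Pol n" by (rule ring_Pol)
  note trs = transport_closed[OF s] and trd = transport_closed[OF d]
  have "transport n d (x \<oplus>\<^bsub>Pol n\<^esub> y) = transport n d x \<oplus>\<^bsub>Pol n\<^esub> transport n d y"
    if "x \<in> carrier (Pol n)" "y \<in> carrier (Pol n)" for x y
    by (rule to_skew_eqI[of _ n]) (simp_all add: trd that assms(3) to_skew_add to_skew_closed)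
  moreover have "transport n d \<one>\<^bsub>Pol n\<^esub> = \<zero>\<^bsub>Pol n\<^esub>"
    by (rule to_skew_eqI[of _ n]) (simp_all add: trd assms(4) to_skew_one to_skew_zero)
  moreover have "transport n d (x \<otimes>\<^bsub>Pol n\<^esub> y) =
      transport n d x \<otimes>\<^bsub>Pol n\<^esub> y \<oplus>\<^bsub>Pol n\<^esub> transport n s x \<otimes>\<^bsub>Pol n\<^esub> transport n d y"
    if "x \<in> carrier (Pol n)" "y \<in> carrier (Pol n)" for x y
    by (rule to_skew_eqI[of _ n])
      (simp_all add: trs trd that assms(5) to_skew_add to_skew_mult to_skew_closed)
  ultimately show ?thesis
    unfolding twisted_derivation_def hom_def using trd(1) by (simp add: Pi_def)
qed

lemma swap_hom_in_skew_polys: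
  assumes "i \<in> {1..<n}" "f \<in> skew_polys n"
  shows "swap_hom i e f \<in> skew_polys n"
  using assms(2)
proof (induction f rule: skew_polys_induct)
  case (X_mult j g)
  have "transpose i (Suc i) j \<in> {1..n}"
    using assms(1) X_mult(1) by (auto simp: transpose_def)
  then have "swap_hom i e (X j) \<in> skew_polys n"
    unfolding swap_hom_X by (intro skew_polys_of_int_mult skew_polys_X)
  then show ?case using X_mult by (simp add: swap_hom_mult skew_polys_mult)
qed (simp_all add: swap_hom_diff skew_polys_zero skew_polys_one skew_polys_diff)

section \<open>Demazure operators as divided differences\<close>

definition square_gap :: "nat \<Rightarrow> skew_poly" where
  "square_gap i = X i * X i - X (Suc i) * X (Suc i)"

lemma X_square: "X i * X i = monom (Poly_Mapping.single i 2)"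
  using X_power[of i 2] by (simp add: power2_eq_square)

lemma square_gap_central: "square_gap i * f = f * square_gap i"
proof -
  have "monom (Poly_Mapping.single j 2) * f = f * monom (Poly_Mapping.single j 2)" for j
    by (rule monom_even_commute) (simp add: lookup_single when_def)
  then show ?thesis by (simp add: square_gap_def X_square algebra_simps)
qed

lemma square_gap_neq_0: "square_gap i \<noteq> 0"
proof
  assume "square_gap i = 0"
  then have "coeff (square_gap i) (Poly_Mapping.single i 2) = 0" by simp
  moreover have "Poly_Mapping.single i 2 \<noteq> (Poly_Mapping.single (Suc i) 2 :: exps)"
    by (metis lookup_single_eq lookup_single_not_eq n_not_Suc_n zero_neq_numeral)
  ultimately show False by (simp add: square_gap_def X_square coeff_monom)
qed

text \<open>
  A twisted derivation for \<open>swap_hom\<close>: it is the inner one given by \<open>swap_direction\<close>.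
\<close>

definition swap_commutator :: "nat \<Rightarrow> nat \<Rightarrow> skew_poly \<Rightarrow> skew_poly" where
  "swap_commutator i e f = swap_direction i e * f - swap_hom i e f * swap_direction i e"

lemma swap_commutator_eq_0_iff: "swap_commutator i e f = 0 \<longleftrightarrow> f \<in> swap_fixed i e"
  by (simp add: swap_commutator_def swap_fixed_def)

lemma swap_commutator_add: "swap_commutator i e (f + g) = swap_commutator i e f + swap_commutator i e g"
  by (simp add: swap_commutator_def swap_hom_add algebra_simps)

lemma swap_commutator_diff: "swap_commutator i e (f - g) = swap_commutator i e f - swap_commutator i e g"
  by (simp add: swap_commutator_def swap_hom_diff algebra_simps)

lemma swap_commutator_mult:
  "swap_commutator i e (f * g) = swap_commutator i e f * g + swap_hom i e f * swap_commutator i e g"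
  by (simp add: swap_commutator_def swap_hom_mult algebra_simps)

lemma swap_commutator_one [simp]: "swap_commutator i e 1 = 0"
  by (simp add: swap_commutator_def)

text \<open>
  The values on the variables: 1 and 1 at \<open>x\<^sub>i\<close>, \<open>x\<^bsub>i+1\<^esub>\<close> for \<open>\<partial>\<^sub>i\<close> (\<open>e = 1\<close>), and 1 and -1 at \<open>x\<^bsub>n-1\<^esub>\<close>, \<open>x\<^sub>n\<close>
  for the type D operator (\<open>e = 0\<close>, \<open>i = n - 1\<close>).
\<close>

definition demazure_value :: "nat \<Rightarrow> nat \<Rightarrow> nat \<Rightarrow> int" where
  "demazure_value i e j = (if j = i then 1 else if j = Suc i then - ((- 1) ^ e) else 0)"

text \<open>
  Variables other than \<open>x\<^sub>i\<close> and \<open>x\<^bsub>i+1\<^esub>\<close> anticommute with the linear form, and for these two the products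
  \<open>x\<^sub>i x\<^bsub>i+1\<^esub>\<close> cancel, so that only squares remain.
\<close>

lemma swap_commutator_X: "swap_commutator i e (X j) = square_gap i * of_int (demazure_value i e j)"
proof -
  consider "j = i" | "j = Suc i" | "j \<notin> {i, Suc i}" by auto
  then show ?thesis
  proof cases
    case 3
    then have "X i * X j = - (X j * X i)" "X (Suc i) * X j = - (X j * X (Suc i))"
      using X_anticommute[of i j] X_anticommute[of "Suc i" j] by (auto simp: eq_neg_iff_add_eq_0)
    then show ?thesis
      using 3 by (cases "even e")
        (auto simp: swap_commutator_def swap_hom_X swap_direction_def demazure_value_def algebra_simps)
  qed (cases "even e"; simp add: swap_commutator_def swap_hom_X swap_direction_def demazure_value_def square_gap_def algebra_simps)+
qed

text \<open>
  The divided difference. The description is meaningful because \<open>square_gap\<close> is not a zero divisor and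
  divides the commutator (\<open>swap_quotient_exists\<close>).
\<close>

definition swap_quotient :: "nat \<Rightarrow> nat \<Rightarrow> skew_poly \<Rightarrow> skew_poly" where
  "swap_quotient i e f = (THE g. square_gap i * g = swap_commutator i e f)"

lemma square_gap_cancel: "square_gap i * f = square_gap i * g \<longleftrightarrow> f = g"
  using square_gap_neq_0 by simp

lemma swap_quotient_eqI: "square_gap i * g = swap_commutator i e f \<Longrightarrow> swap_quotient i e f = g"
  unfolding swap_quotient_def by (rule the_equality) (metis square_gap_cancel)+

lemma square_gap_mult_left: "square_gap i * (f * g) = f * (square_gap i * g)"
  by (metis mult.assoc square_gap_central)

text \<open>
  The elements on which division is possible are closed under left multiplication by variables: in the
  Leibniz rule both terms are divisible, as \<open>square_gap\<close> is central.
\<close>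

lemma swap_quotient_exists:
  assumes i: "i \<in> {1..<n}" and "f \<in> skew_polys n"
  shows "\<exists>g\<in>skew_polys n. square_gap i * g = swap_commutator i e f"
  using assms(2)
proof (induction f rule: skew_polys_induct)
  case zero
  then show ?case using skew_polys_zero by (intro bexI[of _ 0]) (simp_all add: swap_commutator_def)
next
  case one
  then show ?case using skew_polys_zero by (intro bexI[of _ 0]) simp_all
next
  case (X_mult j g)
  then obtain h where h: "h \<in> skew_polys n" "square_gap i * h = swap_commutator i e g" by blast
  show ?case
  proof
    show "of_int (demazure_value i e j) * g + swap_hom i e (X j) * h \<in> skew_polys n"
      using X_mult h i by (intro skew_polys_add skew_polys_mult[of "swap_hom i e (X j)"] skew_polys_of_int_mult
          swap_hom_in_skew_polys skew_polys_X) auto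
    show "square_gap i * (of_int (demazure_value i e j) * g + swap_hom i e (X j) * h) = swap_commutator i e (X j * g)"
      unfolding distrib_left square_gap_mult_left[of i "swap_hom i e (X j)"] h(2) swap_commutator_mult swap_commutator_X
      by (simp add: mult.assoc)
  qed
next
  case (diff f g)
  then obtain p q where "p \<in> skew_polys n" "square_gap i * p = swap_commutator i e f"
    "q \<in> skew_polys n" "square_gap i * q = swap_commutator i e g" by blast
  then show ?case
    by (intro bexI[of _ "p - q"]) (simp_all add: right_diff_distrib swap_commutator_diff skew_polys_diff)
qed

lemma swap_quotient:
  assumes "i \<in> {1..<n}" "f \<in> skew_polys n"
  shows "swap_quotient i e f \<in> skew_polys n" "square_gap i * swap_quotient i e f = swap_commutator i e f"
  using swap_quotient_exists[OF assms, of e] swap_quotient_eqI[of i _ e f] by auto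

lemma swap_quotient_add:
  assumes "i \<in> {1..<n}" "f \<in> skew_polys n" "g \<in> skew_polys n"
  shows "swap_quotient i e (f + g) = swap_quotient i e f + swap_quotient i e g"
  by (rule swap_quotient_eqI)
    (simp add: distrib_left swap_quotient(2)[OF assms(1)] assms swap_commutator_add)

lemma swap_quotient_mult:
  assumes "i \<in> {1..<n}" "f \<in> skew_polys n" "g \<in> skew_polys n"
  shows "swap_quotient i e (f * g) = swap_quotient i e f * g + swap_hom i e f * swap_quotient i e g"
proof (rule swap_quotient_eqI)
  have "square_gap i * (swap_quotient i e f * g) = swap_commutator i e f * g"
    using swap_quotient(2)[OF assms(1,2)] by (simp add: mult.assoc[symmetric])
  then show "square_gap i * (swap_quotient i e f * g + swap_hom i e f * swap_quotient i e g) = swap_commutator i e (f * g)"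
    unfolding distrib_left square_gap_mult_left[of i "swap_hom i e f"] swap_quotient(2)[OF assms(1,3)]
    by (simp add: swap_commutator_mult)
qed

lemma swap_quotient_one: "swap_quotient i e 1 = 0"
  by (rule swap_quotient_eqI) simp

lemma swap_quotient_X: "swap_quotient i e (X j) = of_int (demazure_value i e j)"
  by (rule swap_quotient_eqI) (simp add: swap_commutator_X)

lemma swap_quotient_eq_0_iff:
  assumes "i \<in> {1..<n}" "f \<in> skew_polys n"
  shows "swap_quotient i e f = 0 \<longleftrightarrow> f \<in> swap_fixed i e"
  using swap_quotient(2)[OF assms, of e] square_gap_neq_0[of i]
  by (metis mult_eq_0_iff swap_commutator_eq_0_iff)

lemma transport_swap_hom_ring_hom:
  "i \<in> {1..<n} \<Longrightarrow> transport n (swap_hom i e) \<in> ring_hom (Pol n) (Pol n)"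
  by (intro transport_ring_hom swap_hom_in_skew_polys swap_hom_add swap_hom_mult swap_hom_one)

lemma transport_swap_hom_var:
  assumes i: "i \<in> {1..<n}" and j: "j \<in> {1..n}"
  shows "to_skew (transport n (swap_hom i e) (Pol_var n j)) =
    of_int ((- 1) ^ (if j \<in> {i, Suc i} then e else 1)) * X (transpose i (Suc i) j)"
  using transport_closed(2)[of n "swap_hom i e", OF swap_hom_in_skew_polys[OF i] Pol_var_closed[OF j]]
  by (simp only: to_skew_var[OF j] swap_hom_X)

section \<open>The operators on the quotient ring and their common kernel\<close>

lemma s_map_eq:
  assumes i: "i \<in> {1..<n}"
  shows "s_map n i = transport n (swap_hom i 1)"
proof -
  interpret ring "Pol n" by (rule ring_Pol)
  let ?s = "transport n (swap_hom i 1)"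
  have ij: "i \<in> {1..n}" "Suc i \<in> {1..n}" using i by auto
  have val: "?s (Pol_var n j) = \<ominus>\<^bsub>Pol n\<^esub> Pol_var n (transpose i (Suc i) j)" if j: "j \<in> {1..n}" for j
  proof (rule to_skew_eqI[of _ n])
    have t: "transpose i (Suc i) j \<in> {1..n}" using ij j by (auto simp: transpose_def)
    show "?s (Pol_var n j) \<in> carrier (Pol n)"
      by (rule transport_closed(1)[OF swap_hom_in_skew_polys[OF i] Pol_var_closed[OF j]])
    show "\<ominus>\<^bsub>Pol n\<^esub> Pol_var n (transpose i (Suc i) j) \<in> carrier (Pol n)"
      by (intro a_inv_closed Pol_var_closed t)
    show "to_skew (?s (Pol_var n j)) = to_skew (\<ominus>\<^bsub>Pol n\<^esub> Pol_var n (transpose i (Suc i) j))"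
      unfolding transport_swap_hom_var[OF i j] to_skew_a_inv[OF Pol_var_closed[OF t]] to_skew_var[OF t] by simp
  qed
  show ?thesis
    unfolding s_map_def
  proof (rule the_equality)
    show "?s \<in> ring_hom (Pol n) (Pol n) \<and> ?s \<in> extensional (carrier (Pol n)) \<and>
       ?s (Pol_var n i) = \<ominus>\<^bsub>Pol n\<^esub> Pol_var n (i + 1) \<and>
       ?s (Pol_var n (i + 1)) = \<ominus>\<^bsub>Pol n\<^esub> Pol_var n i \<and>
       (\<forall>j\<in>{1..n} - {i, i + 1}. ?s (Pol_var n j) = \<ominus>\<^bsub>Pol n\<^esub> Pol_var n j)"
      using val[OF ij(1)] val[OF ij(2)] val
      by (auto simp: transport_swap_hom_ring_hom[OF i] transport_extensional)
  next
    fix s assume s: "s \<in> ring_hom (Pol n) (Pol n) \<and> s \<in> extensional (carrier (Pol n)) \<and>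
       s (Pol_var n i) = \<ominus>\<^bsub>Pol n\<^esub> Pol_var n (i + 1) \<and>
       s (Pol_var n (i + 1)) = \<ominus>\<^bsub>Pol n\<^esub> Pol_var n i \<and>
       (\<forall>j\<in>{1..n} - {i, i + 1}. s (Pol_var n j) = \<ominus>\<^bsub>Pol n\<^esub> Pol_var n j)"
    show "s = ?s"
    proof (rule Pol_ring_hom_eqI)
      show "s (Pol_var n j) = ?s (Pol_var n j)" if j: "j \<in> {1..n}" for j
        unfolding val[OF j] using s j by (cases "j = i \<or> j = Suc i") auto
    qed (use s in \<open>simp_all add: transport_swap_hom_ring_hom[OF i] transport_extensional\<close>)
  qed
qed

lemma sD_map_eq:
  assumes n: "n \<ge> 2"
  shows "sD_map n = transport n (swap_hom (n - 1) 0)"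
proof -
  interpret ring "Pol n" by (rule ring_Pol)
  let ?s = "transport n (swap_hom (n - 1) 0)"
  have i: "n - 1 \<in> {1..<n}" "Suc (n - 1) = n" using n by auto
  have val: "?s (Pol_var n j) =
      (if j \<in> {n - 1, n} then Pol_var n (transpose (n - 1) n j) else \<ominus>\<^bsub>Pol n\<^esub> Pol_var n j)"
    (is "_ = ?v") if j: "j \<in> {1..n}" for j
  proof (rule to_skew_eqI[of _ n])
    have t: "transpose (n - 1) n j \<in> {1..n}" using n j by (auto simp: transpose_def)
    show "?s (Pol_var n j) \<in> carrier (Pol n)"
      by (rule transport_closed(1)[OF swap_hom_in_skew_polys[OF i(1)] Pol_var_closed[OF j]])
    show "?v \<in> carrier (Pol n)"
      using t j by (simp add: Pol_var_closed)
    have "to_skew ?v = (if j \<in> {n - 1, n} then X (transpose (n - 1) n j) else - X j)"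
      using to_skew_a_inv[OF Pol_var_closed[OF j]] to_skew_var[OF t] to_skew_var[OF j] by simp
    then show "to_skew (?s (Pol_var n j)) = to_skew ?v"
      unfolding transport_swap_hom_var[OF i(1) j] i(2) by auto
  qed
  have nn: "n \<in> {1..n}" "n - 1 \<in> {1..n}" using n by auto
  show ?thesis
    unfolding sD_map_def
  proof (rule the_equality)
    show "?s \<in> ring_hom (Pol n) (Pol n) \<and> ?s \<in> extensional (carrier (Pol n)) \<and>
       ?s (Pol_var n n) = Pol_var n (n - 1) \<and> ?s (Pol_var n (n - 1)) = Pol_var n n \<and>
       (\<forall>j\<in>{1..n - 2}. ?s (Pol_var n j) = \<ominus>\<^bsub>Pol n\<^esub> Pol_var n j)"
    proof (intro conjI ballI transport_swap_hom_ring_hom[OF i(1)] transport_extensional)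
      show "?s (Pol_var n n) = Pol_var n (n - 1)" "?s (Pol_var n (n - 1)) = Pol_var n n"
        using val[OF nn(1)] val[OF nn(2)] by simp_all
      fix j assume "j \<in> {1..n - 2}"
      then have "j \<in> {1..n}" "j \<notin> {n - 1, n}" by auto
      then show "?s (Pol_var n j) = \<ominus>\<^bsub>Pol n\<^esub> Pol_var n j" by (simp only: val if_False)
    qed
  next
    fix s assume s: "s \<in> ring_hom (Pol n) (Pol n) \<and> s \<in> extensional (carrier (Pol n)) \<and>
       s (Pol_var n n) = Pol_var n (n - 1) \<and> s (Pol_var n (n - 1)) = Pol_var n n \<and>
       (\<forall>j\<in>{1..n - 2}. s (Pol_var n j) = \<ominus>\<^bsub>Pol n\<^esub> Pol_var n j)"
    show "s = ?s"
    proof (rule Pol_ring_hom_eqI)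
      show "s (Pol_var n j) = ?s (Pol_var n j)" if j: "j \<in> {1..n}" for j
      proof (cases "j = n - 1 \<or> j = n")
        case True
        then show ?thesis unfolding val[OF j] using s by auto
      next
        case False
        then have "j \<in> {1..n - 2}" using j by auto
        then show ?thesis unfolding val[OF j] using s False by auto
      qed
    qed (use s in \<open>simp_all only: transport_swap_hom_ring_hom[OF i(1)] transport_extensional\<close>)
  qed
qed

lemma transport_swap_quotient_twisted_derivation:
  assumes i: "i \<in> {1..<n}"
  shows "twisted_derivation (Pol n) (transport n (swap_hom i e)) (transport n (swap_quotient i e))"
  by (rule transport_twisted_derivation)
    (simp_all add: swap_hom_in_skew_polys[OF i] swap_quotient(1)[OF i] swap_quotient_add[OF i]
      swap_quotient_one swap_quotient_mult[OF i])

lemma transport_swap_quotient_var: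
  assumes i: "i \<in> {1..<n}" and j: "j \<in> {1..n}"
    and c: "c \<in> carrier (Pol n)" "to_skew c = of_int (demazure_value i e j)"
  shows "transport n (swap_quotient i e) (Pol_var n j) = c"
proof (rule to_skew_eqI[of _ n])
  show "transport n (swap_quotient i e) (Pol_var n j) \<in> carrier (Pol n)"
    by (rule transport_closed(1)[OF swap_quotient(1)[OF i] Pol_var_closed[OF j]])
  show "to_skew (transport n (swap_quotient i e) (Pol_var n j)) = to_skew c"
    using transport_closed(2)[of n "swap_quotient i e", OF swap_quotient(1)[OF i] Pol_var_closed[OF j]]
    by (simp only: to_skew_var[OF j] swap_quotient_X c(2))
qed (fact c(1))

lemma demazure_eq:
  assumes i: "i \<in> {1..<n}"
  shows "demazure n i = transport n (swap_quotient i 1)"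
proof -
  interpret ring "Pol n" by (rule ring_Pol)
  let ?d = "transport n (swap_quotient i 1)"
  have val: "?d (Pol_var n j) = (if j \<in> {i, i + 1} then \<one>\<^bsub>Pol n\<^esub> else \<zero>\<^bsub>Pol n\<^esub>)" if "j \<in> {1..n}" for j
    by (rule transport_swap_quotient_var[OF i that]) (auto simp: to_skew_one to_skew_zero demazure_value_def)
  have der: "twisted_derivation (Pol n) (s_map n i) ?d"
    unfolding s_map_eq[OF i] by (rule transport_swap_quotient_twisted_derivation[OF i])
  show ?thesis
    unfolding demazure_def
  proof (rule the_equality)
    show "twisted_derivation (Pol n) (s_map n i) ?d \<and> ?d \<in> extensional (carrier (Pol n)) \<and>
        (\<forall>j\<in>{1..n}. ?d (Pol_var n j) = (if j \<in> {i, i + 1} then \<one>\<^bsub>Pol n\<^esub> else \<zero>\<^bsub>Pol n\<^esub>))"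
      using der val transport_extensional by blast
  next
    fix d assume "twisted_derivation (Pol n) (s_map n i) d \<and> d \<in> extensional (carrier (Pol n)) \<and>
        (\<forall>j\<in>{1..n}. d (Pol_var n j) = (if j \<in> {i, i + 1} then \<one>\<^bsub>Pol n\<^esub> else \<zero>\<^bsub>Pol n\<^esub>))"
    then show "d = ?d"
      using val by (intro twisted_derivation_eqI[OF _ _ der transport_extensional]) auto
  qed
qed

lemma demazureD_eq:
  assumes n: "n \<ge> 2"
  shows "demazureD n = transport n (swap_quotient (n - 1) 0)"
proof -
  interpret ring "Pol n" by (rule ring_Pol)
  let ?d = "transport n (swap_quotient (n - 1) 0)"
  have i: "n - 1 \<in> {1..<n}" "Suc (n - 1) = n" using n by auto
  have nn: "n \<in> {1..n}" "n - 1 \<in> {1..n}" using n by auto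
  have val: "?d (Pol_var n n) = \<ominus>\<^bsub>Pol n\<^esub> \<one>\<^bsub>Pol n\<^esub>" "?d (Pol_var n (n - 1)) = \<one>\<^bsub>Pol n\<^esub>"
  proof -
    have "demazure_value (n - 1) 0 n = - 1" "demazure_value (n - 1) 0 (n - 1) = 1"
      using n by (auto simp: demazure_value_def)
    then show "?d (Pol_var n n) = \<ominus>\<^bsub>Pol n\<^esub> \<one>\<^bsub>Pol n\<^esub>" "?d (Pol_var n (n - 1)) = \<one>\<^bsub>Pol n\<^esub>"
      using transport_swap_quotient_var[OF i(1) nn(1), of "\<ominus>\<^bsub>Pol n\<^esub> \<one>\<^bsub>Pol n\<^esub>" 0]
        transport_swap_quotient_var[OF i(1) nn(2), of "\<one>\<^bsub>Pol n\<^esub>" 0]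
      by (simp_all add: to_skew_one to_skew_a_inv)
  qed
  have val0: "?d (Pol_var n j) = \<zero>\<^bsub>Pol n\<^esub>" if "j \<in> {1..n - 2}" for j
    by (rule transport_swap_quotient_var[OF i(1)]) (use n that in \<open>auto simp: to_skew_zero demazure_value_def\<close>)
  have der: "twisted_derivation (Pol n) (sD_map n) ?d"
    unfolding sD_map_eq[OF n] by (rule transport_swap_quotient_twisted_derivation[OF i(1)])
  show ?thesis
    unfolding demazureD_def
  proof (rule the_equality)
    show "twisted_derivation (Pol n) (sD_map n) ?d \<and> ?d \<in> extensional (carrier (Pol n)) \<and>
        ?d (Pol_var n n) = \<ominus>\<^bsub>Pol n\<^esub> \<one>\<^bsub>Pol n\<^esub> \<and> ?d (Pol_var n (n - 1)) = \<one>\<^bsub>Pol n\<^esub> \<and>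
        (\<forall>j\<in>{1..n - 2}. ?d (Pol_var n j) = \<zero>\<^bsub>Pol n\<^esub>)"
      using der val val0 transport_extensional by blast
  next
    fix d assume d: "twisted_derivation (Pol n) (sD_map n) d \<and> d \<in> extensional (carrier (Pol n)) \<and>
        d (Pol_var n n) = \<ominus>\<^bsub>Pol n\<^esub> \<one>\<^bsub>Pol n\<^esub> \<and> d (Pol_var n (n - 1)) = \<one>\<^bsub>Pol n\<^esub> \<and>
        (\<forall>j\<in>{1..n - 2}. d (Pol_var n j) = \<zero>\<^bsub>Pol n\<^esub>)"
    show "d = ?d"
    proof (rule twisted_derivation_eqI[OF _ _ der transport_extensional])
      fix j assume j: "j \<in> {1..n}"
      have "j = n \<or> j = n - 1 \<or> j \<in> {1..n - 2}" using j by auto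
      then show "d (Pol_var n j) = ?d (Pol_var n j)" using d val val0 by metis
    qed (use d in auto)
  qed
qed

text \<open>
  Division by \<open>square_gap\<close> does not change the kernel, so membership is the condition studied for
  \<open>swap_fixed\<close>.
\<close>

lemma LambdaD_iff:
  assumes n: "n \<ge> 2"
  shows "x \<in> LambdaD n \<longleftrightarrow> x \<in> carrier (Pol n) \<and> to_skew x \<in> typeD_polys n"
proof -
  interpret ring "Pol n" by (rule ring_Pol)
  have ker: "transport n (swap_quotient i e) x = \<zero>\<^bsub>Pol n\<^esub> \<longleftrightarrow> to_skew x \<in> swap_fixed i e"
    if x: "x \<in> carrier (Pol n)" and i: "i \<in> {1..<n}" for i e
  proof -
    note tr = transport_closed[of n "swap_quotient i e", OF swap_quotient(1)[OF i] x]
    have "transport n (swap_quotient i e) x = \<zero>\<^bsub>Pol n\<^esub> \<longleftrightarrow> swap_quotient i e (to_skew x) = 0"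
      using to_skew_eqI[OF tr(1) zero_closed] tr(2) to_skew_zero[of n] by auto
    also have "\<dots> \<longleftrightarrow> to_skew x \<in> swap_fixed i e"
      by (rule swap_quotient_eq_0_iff[OF i to_skew_closed[OF x]])
    finally show ?thesis .
  qed
  have set: "{1..n - 1} = {1..<n}" using n by auto
  have "x \<in> LambdaD n \<longleftrightarrow> x \<in> carrier (Pol n) \<and>
      (\<forall>i\<in>{1..<n}. transport n (swap_quotient i 1) x = \<zero>\<^bsub>Pol n\<^esub>) \<and>
      transport n (swap_quotient (n - 1) 0) x = \<zero>\<^bsub>Pol n\<^esub>"
    unfolding LambdaD_def set a_kernel_def' demazureD_eq[OF n] using demazure_eq by auto
  also have "\<dots> \<longleftrightarrow> x \<in> carrier (Pol n) \<and>
      ((\<forall>i\<in>{1..<n}. to_skew x \<in> swap_fixed i 1) \<and> to_skew x \<in> swap_fixed (n - 1) 0)"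
  proof (cases "x \<in> carrier (Pol n)")
    case True
    have "n - 1 \<in> {1..<n}" using n by auto
    then show ?thesis using ker[OF True] by blast
  qed simp
  also have "\<dots> \<longleftrightarrow> x \<in> carrier (Pol n) \<and> to_skew x \<in> typeD_polys n"
    unfolding typeD_symmetric_iff_swap_fixed[OF n] typeD_polys_def using to_skew_closed by auto
  finally show ?thesis .
qed

lemma to_skew_list_prod:
  assumes "set xs \<subseteq> carrier (Pol n)"
  shows "list_prod (Pol n) xs \<in> carrier (Pol n) \<and>
    to_skew (list_prod (Pol n) xs) = prod_list (map to_skew xs)"
proof -
  interpret ring "Pol n" by (rule ring_Pol)
  show ?thesis
    using assms by (induction xs) (auto simp: list_prod_def to_skew_one to_skew_mult)
qed

lemma to_skew_finsum:
  assumes "finite A" "\<And>a. a \<in> A \<Longrightarrow> g a \<in> carrier (Pol n)"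
  shows "to_skew (\<Oplus>\<^bsub>Pol n\<^esub>a\<in>A. g a) = (\<Sum>a\<in>A. to_skew (g a))"
proof -
  interpret ring "Pol n" by (rule ring_Pol)
  show ?thesis
    using assms
  proof (induction A rule: finite_induct)
    case (insert a A)
    have "g \<in> A \<rightarrow> carrier (Pol n)" using insert.prems by auto
    then show ?case using insert by (simp add: to_skew_add finsum_insert)
  qed (simp add: to_skew_zero)
qed

lemma prod_list_X_power:
  assumes "sorted_wrt (<) ks"
  shows "prod_list (map (\<lambda>i. X i ^ c) ks) = monom (const_exps c (set ks))"
proof -
  have "distinct ks" using assms by (induction ks) auto
  then show ?thesis
    unfolding X_power prod_list_increasing_monoms[OF assms] const_exps_def
    by (simp add: sum_list_distinct_conv_sum_set)
qed

lemma to_skew_epsD: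
  assumes "k \<in> {1..n}"
  shows "epsD n k \<in> carrier (Pol n)" "to_skew (epsD n k) = elementary n k"
proof -
  interpret ring "Pol n" by (rule ring_Pol)
  have sq: "to_skew (Pol_var n i [^]\<^bsub>Pol n\<^esub> (2::nat)) = X i ^ 2" if "i \<in> {1..n}" for i
    using Pol_var_closed[OF that]
    by (simp add: numeral_2_eq_2 to_skew_mult to_skew_one to_skew_var[OF that] mult.assoc)
  let ?S = "{I. I \<subseteq> {1..n} \<and> card I = k}"
  let ?p = "\<lambda>I. list_prod (Pol n) (map (\<lambda>i. Pol_var n i [^]\<^bsub>Pol n\<^esub> (2::nat)) (sorted_list_of_set I))"
  have fin: "finite ?S" by (rule finite_subset[of _ "Pow {1..n}"]) auto
  have p: "?p I \<in> carrier (Pol n)" "to_skew (?p I) = monom (const_exps 2 I)" if "I \<in> ?S" for I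
  proof -
    have I: "finite I" "I \<subseteq> {1..n}" using that finite_subset[of I "{1..n}"] by auto
    have cl: "set (map (\<lambda>i. Pol_var n i [^]\<^bsub>Pol n\<^esub> (2::nat)) (sorted_list_of_set I)) \<subseteq> carrier (Pol n)"
      using I Pol_var_closed by auto
    have "map to_skew (map (\<lambda>i. Pol_var n i [^]\<^bsub>Pol n\<^esub> (2::nat)) (sorted_list_of_set I)) =
        map (\<lambda>i. X i ^ 2) (sorted_list_of_set I)"
      using I sq by (simp add: subset_eq)
    moreover have "prod_list (map (\<lambda>i. X i ^ 2) (sorted_list_of_set I)) = monom (const_exps 2 I)"
      using prod_list_X_power[of "sorted_list_of_set I" 2] I by simp
    ultimately show "?p I \<in> carrier (Pol n)" "to_skew (?p I) = monom (const_exps 2 I)"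
      using to_skew_list_prod[OF cl] by (simp_all only:)
  qed
  have cl: "set (map (Pol_var n) [1..<n + 1]) \<subseteq> carrier (Pol n)"
    using Pol_var_closed by auto
  have "map to_skew (map (Pol_var n) [1..<n + 1]) = map (\<lambda>i. X i ^ 1) [1..<n + 1]"
    using to_skew_var by auto
  moreover have "prod_list (map (\<lambda>i. X i ^ 1) [1..<n + 1]) = monom (const_exps 1 {1..n})"
    using prod_list_X_power[of "[1..<n + 1]" 1] by (simp add: atLeastLessThanSuc_atLeastAtMost del: upt_Suc)
  ultimately have last: "list_prod (Pol n) (map (Pol_var n) [1..<n + 1]) \<in> carrier (Pol n)"
    "to_skew (list_prod (Pol n) (map (Pol_var n) [1..<n + 1])) = monom (const_exps 1 {1..n})"
    using to_skew_list_prod[OF cl] by (simp_all only:)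
  show "epsD n k \<in> carrier (Pol n)"
    using p(1) last(1) unfolding epsD_def by (auto intro!: finsum_closed)
  show "to_skew (epsD n k) = elementary n k"
  proof (cases "k < n")
    case True
    have "to_skew (epsD n k) = (\<Sum>I\<in>?S. to_skew (?p I))"
      using True to_skew_finsum[OF fin p(1)] by (simp add: epsD_def)
    also have "\<dots> = elementary n k"
      using True p(2) by (simp add: elementary_def)
    finally show ?thesis .
  next
    case False
    then show ?thesis using last(2) unfolding epsD_def elementary_def by simp
  qed
qed

lemma subring_LambdaD:
  assumes n: "n \<ge> 2"
  shows "subring (LambdaD n) (Pol n)"
proof -
  interpret ring "Pol n" by (rule ring_Pol)
  note T = typeD_polys_closed[OF n]
  have T0: "0 \<in> typeD_polys n" using T(2)[OF T(1) T(1)] by simp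
  have Tm: "- f \<in> typeD_polys n" if "f \<in> typeD_polys n" for f using T(2)[OF T0 that] by simp
  have Ta: "f + g \<in> typeD_polys n" if "f \<in> typeD_polys n" "g \<in> typeD_polys n" for f g
    using T(2)[OF that(1) Tm[OF that(2)]] by simp
  show ?thesis
    by (rule subringI)
      (auto simp: LambdaD_iff[OF n] to_skew_one to_skew_a_inv to_skew_mult to_skew_add intro: T Tm Ta)
qed

theorem proposition3p10:
  fixes n :: nat
  assumes "n \<ge> 2"
  shows "polynomial_algebra_generated_by (Pol n) (LambdaD n) n (epsD n)"
proof -
  interpret ring "Pol n" by (rule ring_Pol)
  let ?\<phi> = "\<lambda>p. from_skew n (eval_elementary n p)"
  let ?C = "carrier (int_poly_ring n)"
  have C: "p \<in> ?C \<longleftrightarrow> (\<forall>\<mu>\<in>Poly_Mapping.keys p. Poly_Mapping.keys \<mu> \<subseteq> {1..n})" for p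
    by (simp add: int_poly_ring_def)
  have Cdiff: "p - q \<in> ?C" if "p \<in> ?C" "q \<in> ?C" for p q
    using that keys_diff[of p q] unfolding C by blast
  have E: "eval_elementary n p \<in> typeD_polys n" "eval_elementary n p \<in> skew_polys n" for p
    using eval_elementary_in_typeD_polys[OF assms] by (auto simp: typeD_polys_def)
  have \<phi>: "?\<phi> p \<in> carrier (Pol n)" "to_skew (?\<phi> p) = eval_elementary n p" for p
    using E(2) by (simp_all add: from_skew_closed to_skew_from_skew)
  have \<phi>_eqI: "?\<phi> p = x" if "x \<in> carrier (Pol n)" "to_skew x = eval_elementary n p" for p x
    using that by (intro to_skew_eqI[of _ n]) (simp_all add: \<phi>)
  have "?\<phi> \<in> ring_hom (int_poly_ring n) (Pol n\<lparr>carrier := LambdaD n\<rparr>)"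
  proof (rule ring_hom_memI)
    show "?\<phi> p \<in> carrier (Pol n\<lparr>carrier := LambdaD n\<rparr>)" for p
      using E \<phi> by (simp add: LambdaD_iff[OF assms])
    show "?\<phi> (p \<otimes>\<^bsub>int_poly_ring n\<^esub> q) = ?\<phi> p \<otimes>\<^bsub>Pol n\<lparr>carrier := LambdaD n\<rparr>\<^esub> ?\<phi> q" for p q
      by (intro \<phi>_eqI) (simp_all add: int_poly_ring_def \<phi> to_skew_mult eval_elementary_mult)
    show "?\<phi> (p \<oplus>\<^bsub>int_poly_ring n\<^esub> q) = ?\<phi> p \<oplus>\<^bsub>Pol n\<lparr>carrier := LambdaD n\<rparr>\<^esub> ?\<phi> q" for p q
      by (intro \<phi>_eqI) (simp_all add: int_poly_ring_def \<phi> to_skew_add eval_elementary_add)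
    show "?\<phi> \<one>\<^bsub>int_poly_ring n\<^esub> = \<one>\<^bsub>Pol n\<lparr>carrier := LambdaD n\<rparr>\<^esub>"
      by (intro \<phi>_eqI) (simp_all add: int_poly_ring_def to_skew_one eval_elementary_one)
  qed
  moreover have "bij_betw ?\<phi> ?C (LambdaD n)"
  proof (rule bij_betw_imageI)
    show "inj_on ?\<phi> ?C"
    proof (rule inj_onI)
      fix p q assume pq: "p \<in> ?C" "q \<in> ?C" "?\<phi> p = ?\<phi> q"
      have "eval_elementary n p = to_skew (?\<phi> q)" by (simp only: \<phi>(2) flip: pq(3))
      then have "eval_elementary n (p - q) = 0" by (simp only: \<phi>(2) eval_elementary_diff diff_self)
      moreover have "Poly_Mapping.keys \<mu> \<subseteq> {1..n}" if "\<mu> \<in> Poly_Mapping.keys (p - q)" for \<mu>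
        using Cdiff[OF pq(1,2)] that unfolding C by blast
      ultimately have "p - q = 0" using eval_elementary_eq_0[of n "p - q"] assms by simp
      then show "p = q" by (simp only: right_minus_eq)
    qed
    show "?\<phi> ` ?C = LambdaD n"
    proof
      show "?\<phi> ` ?C \<subseteq> LambdaD n" using E \<phi> by (auto simp: LambdaD_iff[OF assms])
      show "LambdaD n \<subseteq> ?\<phi> ` ?C"
      proof
        fix x assume "x \<in> LambdaD n"
        then have x: "x \<in> carrier (Pol n)" "to_skew x \<in> typeD_polys n" by (simp_all add: LambdaD_iff[OF assms])
        then obtain p where p: "p \<in> ?C" "eval_elementary n p = to_skew x"
          using eval_elementary_surj[OF assms x(2)] unfolding C by blast
        have "x = ?\<phi> p" by (rule \<phi>_eqI[OF x(1) p(2)[symmetric], symmetric])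
        from image_eqI[of x ?\<phi> p ?C, OF this p(1)] show "x \<in> ?\<phi> ` ?C" .
      qed
    qed
  qed
  ultimately have iso: "?\<phi> \<in> ring_iso (int_poly_ring n) (Pol n\<lparr>carrier := LambdaD n\<rparr>)"
    by (simp add: ring_iso_def)
  have gen: "?\<phi> (int_poly_var k) = epsD n k" if "k \<in> {1..n}" for k
    by (rule \<phi>_eqI) (simp_all only: to_skew_epsD[OF that] int_poly_var_def eval_elementary_of elementary_monom_single[OF that])
  show ?thesis
    unfolding polynomial_algebra_generated_by_def
    by (rule conjI[OF subring_LambdaD[OF assms]], rule bexI[OF _ iso], rule ballI, rule gen)
qed

end
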